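(* Let $\Omega\subset\mathbb{C}^m$ be a Carathéodory hyperbolic domain, fix a point $w_0\in\Omega$, and define the family of test functions $$\Psi=\Big\{\psi_f(z)=\frac{f(w_0)-f(z)}{1-\overline{f(w_0)}f(z)}\;:\; f\in\mathscr{S}(\Omega),\ f(\Omega)\subset\mathbb{D}\Big\}.$$ Let $\mathcal{C}_b(\Psi)$ be the $C^*$-algebra of bounded continuous functions on $\Psi$ and, for $z\in\Omega$, let $E(z)\in\mathcal{C}_b(\Psi)$ be the evaluation map $E(z)(\psi)=\psi(z)$, $\psi\in\Psi$. Then, for any holomorphic function $h:\Omega\to\mathbb{C}$, the following are equivalent. (1) $\operatorname{Re}(h(z))\geq 0$ for all $z\in\Omega$. (2) There exist a real number $b$, a Hilbert space $\mathscr{X}$, a unitary operator $U\in B(\mathscr{X})$, a vector $\gamma\in\mathscr{X}$ and a unital $*$-representation $\rho:\mathcal{C}_b(\Psi)\to B(\mathscr{X})$ such that $$h(z)=ib+\Big\langle\gamma,\,(1+U\rho(E(z)^* ))(1-U\rho(E(z)^* ))^{-1}\gamma\Big\rangle\quad\text{for all } z\in\Omega.$$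
   Context: $\mathbb{D}$ is the open unit disc in $\mathbb{C}$. A domain $\Omega\subset\mathbb{C}^m$ is Carathéodory hyperbolic if the bounded holomorphic functions on $\Omega$ separate the points of $\Omega$. The Schur class $\mathscr{S}(\Omega)$ is the closed unit ball, for the supremum norm, of the Banach algebra of bounded holomorphic functions $\Omega\to\mathbb{C}$. A collection $\Psi$ of $\mathbb{C}$-valued functions on $\Omega$ is a set of test functions if (i) $\sup\{|\psi(z)|:\psi\in\Psi\}<1$ for each $z\in\Omega$; and (ii) for each finite subset $F\subset\Omega$, the restrictions $\{\psi|_F:\psi\in\Psi\}$ together with the constant function generate the algebra of all $\mathbb{C}$-valued functions on $F$. The set $\Psi$ is topologized as a subspace of $\overline{\mathbb{D}}^{\Omega}$ with the product topology (pointwise convergence). The involution in $\mathcal{C}_b(\Psi)$ is complex conjugation, so $E(z)^*(\psi)=\overline{\psi(z)}$, and the norm is the supremum norm. $B(\mathscr{X})$ is the algebra of bounded operators on $\mathscr{X}$. Inner products are linear in the first argument and conjugate-linear in the second. *)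

theory Defs
  imports "HOL-Analysis.Analysis" "HOL-Algebra.Algebraic_Closure_Type"
begin

definition domain_Cm :: "(complex ^ 'm) set \<Rightarrow> bool" where
  "domain_Cm \<Omega> \<longleftrightarrow> open \<Omega> \<and> connected \<Omega> \<and> \<Omega> \<noteq> {}"

text \<open>The library notion \<^const>\<open>holomorphic_on\<close> covers one complex variable only.
  In several variables a function is holomorphic if it has a complex-linear Frechet derivative
  at each point; \<^term>\<open>(*s)\<close> is scalar multiplication by complex numbers.\<close>

definition holomorphic_Cm :: "(complex ^ 'm \<Rightarrow> complex) \<Rightarrow> (complex ^ 'm) set \<Rightarrow> bool" where
  "holomorphic_Cm f \<Omega> \<longleftrightarrow>
     (\<forall>z\<in>\<Omega>. \<exists>D. (f has_derivative D) (at z) \<and> (\<forall>c v. D (c *s v) = c * D v))"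

definition caratheodory_hyperbolic :: "(complex ^ 'm) set \<Rightarrow> bool" where
  "caratheodory_hyperbolic \<Omega> \<longleftrightarrow>
     (\<forall>z\<in>\<Omega>. \<forall>w\<in>\<Omega>. z \<noteq> w \<longrightarrow>
        (\<exists>f. holomorphic_Cm f \<Omega> \<and> bounded (f ` \<Omega>) \<and> f z \<noteq> f w))"

definition schur_class :: "(complex ^ 'm) set \<Rightarrow> (complex ^ 'm \<Rightarrow> complex) set" where
  "schur_class \<Omega> = {f. holomorphic_Cm f \<Omega> \<and> (\<forall>z\<in>\<Omega>. norm (f z) \<le> 1)}"

text \<open>\<open>gen_algebra F S\<close> is the algebra of functions on \<open>F\<close> generated by the restrictions to \<open>F\<close> of
  the members of \<open>S\<close> together with the constants. Functions on a set are represented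
  extensionally.\<close>

inductive_set gen_algebra :: "'a set \<Rightarrow> ('a \<Rightarrow> complex) set \<Rightarrow> ('a \<Rightarrow> complex) set"
  for F :: "'a set" and S :: "('a \<Rightarrow> complex) set" where
  gen: "g \<in> S \<Longrightarrow> restrict g F \<in> gen_algebra F S"
| const: "(\<lambda>z\<in>F. c) \<in> gen_algebra F S"
| add: "\<lbrakk>f \<in> gen_algebra F S; g \<in> gen_algebra F S\<rbrakk> \<Longrightarrow> (\<lambda>z\<in>F. f z + g z) \<in> gen_algebra F S"
| mult: "\<lbrakk>f \<in> gen_algebra F S; g \<in> gen_algebra F S\<rbrakk> \<Longrightarrow> (\<lambda>z\<in>F. f z * g z) \<in> gen_algebra F S"

text \<open>The supremum is taken in the extended reals, since the real \<^const>\<open>Sup\<close> has no meaning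
  for unbounded sets.\<close>

definition test_functions :: "'a set \<Rightarrow> ('a \<Rightarrow> complex) set \<Rightarrow> bool" where
  "test_functions \<Omega> \<Psi> \<longleftrightarrow>
     (\<forall>z\<in>\<Omega>. (SUP \<psi>\<in>\<Psi>. ereal (norm (\<psi> z))) < 1) \<and>
     (\<forall>F. finite F \<and> F \<subseteq> \<Omega> \<longrightarrow> gen_algebra F \<Psi> = (F \<rightarrow>\<^sub>E UNIV))"

definition Psi :: "(complex ^ 'm) set \<Rightarrow> complex ^ 'm \<Rightarrow> (complex ^ 'm \<Rightarrow> complex) set" where
  "Psi \<Omega> w0 =
     {(\<lambda>z\<in>\<Omega>. (f w0 - f z) / (1 - cnj (f w0) * f z)) | f. f \<in> schur_class \<Omega> \<and> f ` \<Omega> \<subseteq> ball 0 1}"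

definition test_topology :: "'a set \<Rightarrow> ('a \<Rightarrow> complex) set \<Rightarrow> ('a \<Rightarrow> complex) topology" where
  "test_topology \<Omega> \<Psi> = subtopology (product_topology (\<lambda>_. top_of_set (cball 0 1)) \<Omega>) \<Psi>"

definition Cb :: "'t topology \<Rightarrow> ('t \<Rightarrow> complex) set" where
  "Cb Y = mspace (cfunspace Y euclidean_metric)"

definition Cb_star :: "'t topology \<Rightarrow> ('t \<Rightarrow> complex) \<Rightarrow> ('t \<Rightarrow> complex)" where
  "Cb_star Y a = (\<lambda>t\<in>topspace Y. cnj (a t))"

definition evaluation :: "('a \<Rightarrow> complex) topology \<Rightarrow> 'a \<Rightarrow> ('a \<Rightarrow> complex) \<Rightarrow> complex" where
  "evaluation Y z = (\<lambda>\<psi>\<in>topspace Y. \<psi> z)"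

text \<open>Hilbert spaces are quantified inside the theorem, so they are structures with an explicit
  carrier inside a type \<open>'x\<close>. HOL cannot quantify existentially over types, so \<open>'x\<close> is a
  universe of possible vectors; a nonzero Hilbert space fits into \<open>'x\<close> only if the complex
  numbers inject into it. The multiplicative fields inherited from the ring record are
  irrelevant, as is usual for modules.\<close>

record 'x cinner_space = "(complex, 'x) module" +
  cinner :: "'x \<Rightarrow> 'x \<Rightarrow> complex"

definition hnorm :: "('x, 'r) cinner_space_scheme \<Rightarrow> 'x \<Rightarrow> real" where
  "hnorm H x = sqrt (Re (cinner H x x))"

text \<open>The value 0 off the carrier is needed because the locale \<^locale>\<open>Metric_space\<close> asks for
  nonnegativity and symmetry on the whole type.\<close>

definition hdist :: "('x, 'r) cinner_space_scheme \<Rightarrow> 'x \<Rightarrow> 'x \<Rightarrow> real" where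
  "hdist H x y = (if x \<in> carrier H \<and> y \<in> carrier H then hnorm H (x \<ominus>\<^bsub>H\<^esub> y) else 0)"

definition hilbert_space :: "('x, 'r) cinner_space_scheme \<Rightarrow> bool" where
  "hilbert_space H \<longleftrightarrow>
     Module.module (ring_of_type_algebra :: complex ring) H \<and>
     (\<forall>x\<in>carrier H. \<forall>y\<in>carrier H. \<forall>z\<in>carrier H.
        cinner H (x \<oplus>\<^bsub>H\<^esub> y) z = cinner H x z + cinner H y z) \<and>
     (\<forall>c. \<forall>x\<in>carrier H. \<forall>y\<in>carrier H. cinner H (c \<odot>\<^bsub>H\<^esub> x) y = c * cinner H x y) \<and>
     (\<forall>x\<in>carrier H. \<forall>y\<in>carrier H. cinner H y x = cnj (cinner H x y)) \<and>
     (\<forall>x\<in>carrier H. 0 \<le> Re (cinner H x x)) \<and>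
     (\<forall>x\<in>carrier H. cinner H x x = 0 \<longrightarrow> x = \<zero>\<^bsub>H\<^esub>) \<and>
     Metric_space.mcomplete (carrier H) (hdist H)"

text \<open>Operators are functions on the whole type; only their values on the carrier matter, and
  equality of operators is always equality on the carrier.\<close>

definition bounded_operator :: "('x, 'r) cinner_space_scheme \<Rightarrow> ('x \<Rightarrow> 'x) \<Rightarrow> bool" where
  "bounded_operator H T \<longleftrightarrow>
     T \<in> carrier H \<rightarrow> carrier H \<and>
     (\<forall>x\<in>carrier H. \<forall>y\<in>carrier H. T (x \<oplus>\<^bsub>H\<^esub> y) = T x \<oplus>\<^bsub>H\<^esub> T y) \<and>
     (\<forall>c. \<forall>x\<in>carrier H. T (c \<odot>\<^bsub>H\<^esub> x) = c \<odot>\<^bsub>H\<^esub> T x) \<and>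
     (\<exists>K. \<forall>x\<in>carrier H. hnorm H (T x) \<le> K * hnorm H x)"

definition is_adjoint :: "('x, 'r) cinner_space_scheme \<Rightarrow> ('x \<Rightarrow> 'x) \<Rightarrow> ('x \<Rightarrow> 'x) \<Rightarrow> bool" where
  "is_adjoint H T S \<longleftrightarrow>
     (\<forall>x\<in>carrier H. \<forall>y\<in>carrier H. cinner H (T x) y = cinner H x (S y))"

definition is_inverse_op :: "('x, 'r) cinner_space_scheme \<Rightarrow> ('x \<Rightarrow> 'x) \<Rightarrow> ('x \<Rightarrow> 'x) \<Rightarrow> bool" where
  "is_inverse_op H T S \<longleftrightarrow> (\<forall>x\<in>carrier H. S (T x) = x \<and> T (S x) = x)"

definition unitary_operator :: "('x, 'r) cinner_space_scheme \<Rightarrow> ('x \<Rightarrow> 'x) \<Rightarrow> bool" where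
  "unitary_operator H U \<longleftrightarrow>
     bounded_operator H U \<and>
     (\<exists>V. bounded_operator H V \<and> is_adjoint H U V \<and> is_inverse_op H U V)"

text \<open>The inverse in the algebra of bounded operators, unique on the carrier when it exists.\<close>

definition op_inverse :: "('x, 'r) cinner_space_scheme \<Rightarrow> ('x \<Rightarrow> 'x) \<Rightarrow> 'x \<Rightarrow> 'x" where
  "op_inverse H T = (SOME S. bounded_operator H S \<and> is_inverse_op H T S)"

definition unital_star_representation ::
    "'t topology \<Rightarrow> ('x, 'r) cinner_space_scheme \<Rightarrow> (('t \<Rightarrow> complex) \<Rightarrow> 'x \<Rightarrow> 'x) \<Rightarrow> bool" where
  "unital_star_representation Y H \<rho> \<longleftrightarrow>
     (\<forall>a\<in>Cb Y. bounded_operator H (\<rho> a)) \<and>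
     (\<forall>a\<in>Cb Y. \<forall>b\<in>Cb Y. \<forall>x\<in>carrier H.
        \<rho> (\<lambda>t\<in>topspace Y. a t + b t) x = \<rho> a x \<oplus>\<^bsub>H\<^esub> \<rho> b x) \<and>
     (\<forall>c. \<forall>a\<in>Cb Y. \<forall>x\<in>carrier H. \<rho> (\<lambda>t\<in>topspace Y. c * a t) x = c \<odot>\<^bsub>H\<^esub> \<rho> a x) \<and>
     (\<forall>a\<in>Cb Y. \<forall>b\<in>Cb Y. \<forall>x\<in>carrier H. \<rho> (\<lambda>t\<in>topspace Y. a t * b t) x = \<rho> a (\<rho> b x)) \<and>
     (\<forall>a\<in>Cb Y. is_adjoint H (\<rho> a) (\<rho> (Cb_star Y a))) \<and>
     (\<forall>x\<in>carrier H. \<rho> (\<lambda>t\<in>topspace Y. 1) x = x)"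

definition cayley :: "('x, 'r) cinner_space_scheme \<Rightarrow> ('x \<Rightarrow> 'x) \<Rightarrow> 'x \<Rightarrow> 'x" where
  "cayley H T x = (let y = op_inverse H (\<lambda>v. v \<ominus>\<^bsub>H\<^esub> T v) x in y \<oplus>\<^bsub>H\<^esub> T y)"

end

theory Submission
  imports Defs "HOL-Complex_Analysis.Complex_Analysis"
begin

text \<open>
  The family \<^term>\<open>Psi \<Omega> w0\<close> consists of all holomorphic maps from \<open>\<Omega>\<close> into the open disc that vanish
  at \<open>w0\<close>: composing \<open>f\<close> with the disc automorphism that exchanges \<open>f w0\<close> and \<open>0\<close> gives such a map,
  and a map \<open>\<phi>\<close> with \<open>\<phi> w0 = 0\<close> is the test function of \<open>- \<phi>\<close>. This makes the family large enough
  for each function of nonnegative real part to be realized by a single test function.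

  Suppose \<open>Re h \<ge> 0\<close> and write \<open>h w0 = r + \<i> b\<close>. If \<open>r > 0\<close>, the Cayley transform
  \<open>\<phi> = (h - \<i> b - r) / (h - \<i> b + r)\<close> has modulus at most 1 and vanishes at \<open>w0\<close>; by the maximum
  principle it maps into the open disc, so it is a test function, and
  \<open>h = \<i> b + r (1 + \<phi>) / (1 - \<phi>)\<close>. If \<open>r = 0\<close>, the maximum principle forces \<open>h\<close> to be the constant
  \<open>\<i> b\<close>. These are the two cases of \<open>nonneg_real_part_cases\<close>. The formula for \<open>h\<close> is already an operator
  realization on a one-dimensional Hilbert space: the representation is the character
  \<open>a \<mapsto> a \<phi>\<close> of the algebra of bounded continuous functions, the unitary is the identity, and
  \<open>\<gamma> = sqrt r\<close> (\<open>realization_from_test_function\<close>). Since the operator stands in the second,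
  conjugate-linear argument of the inner product, the conjugate in \<open>E z\<close>-star turns into \<open>\<phi> z\<close>.

  Conversely, for \<open>T = U \<rho> (E z)*\<close> and \<open>y = (1 - T)\<inverse> \<gamma>\<close> one has
  \<open>Re \<langle>\<gamma>, (1 + T) y\<rangle> = Re \<langle>y - T y, y + T y\<rangle> = \<parallel>y\<parallel>\<^sup>2 - \<parallel>T y\<parallel>\<^sup>2 \<ge> 0\<close>, provided that \<open>T\<close> is a strict contraction.
  A unital star representation does not increase norms, so this comes down to
  \<open>sup {\<bar>\<psi> z\<bar> | \<psi>. \<psi> \<in> \<Psi>} < 1\<close>, which is also the first condition on test functions.

  That bound (\<open>Psi_uniformly_bounded\<close>) is a Harnack-type argument: at \<open>w0\<close> all test functions vanish, the
  Schwarz-Pick lemma on complex discs in \<open>\<Omega>\<close> carries a uniform bound below 1 from a point to its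
  neighbours, and \<open>\<Omega>\<close> is connected. The second condition on test functions is interpolation: bounded
  holomorphic functions separate points, rescaling makes them disc-valued, and disc automorphisms are
  injective.
\<close>

section \<open>Blaschke factors of the disc\<close>

definition blaschke :: "complex \<Rightarrow> complex \<Rightarrow> complex" where
  "blaschke a w = (a - w) / (1 - cnj a * w)"

lemma blaschke_denominator_nonzero:
  assumes "norm a < 1" "norm w \<le> 1"
  shows "1 - cnj a * w \<noteq> 0"
proof
  assume "1 - cnj a * w = 0"
  then have "norm a * norm w = 1"
    by (metis complex_mod_cnj eq_iff_diff_eq_0 norm_mult norm_one)
  moreover have "norm a * norm w \<le> norm a * 1"
    using assms by (intro mult_left_mono) auto
  ultimately show False
    using assms by simp
qed

lemma blaschke_defect:
  assumes "norm a < 1" "norm w < 1"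
  shows "1 - (norm (blaschke a w))\<^sup>2
         = (1 - (norm a)\<^sup>2) * (1 - (norm w)\<^sup>2) / (norm (1 - cnj a * w))\<^sup>2"
proof -
  have nz: "1 - cnj a * w \<noteq> 0"
    using blaschke_denominator_nonzero[of a w] assms by simp
  have "(norm (1 - cnj a * w))\<^sup>2 - (norm (a - w))\<^sup>2 = (1 - (norm a)\<^sup>2) * (1 - (norm w)\<^sup>2)"
    unfolding cmod_power2 by (simp add: algebra_simps power2_eq_square)
  then show ?thesis
    using nz by (simp add: blaschke_def norm_divide power_divide field_simps)
qed

lemma norm_blaschke_less_1:
  assumes "norm a < 1" "norm w < 1"
  shows "norm (blaschke a w) < 1"
proof -
  have "(1 - (norm a)\<^sup>2) * (1 - (norm w)\<^sup>2) / (norm (1 - cnj a * w))\<^sup>2 > 0"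
    using assms blaschke_denominator_nonzero[of a w]
    by (intro divide_pos_pos mult_pos_pos) (auto simp: power_less_one_iff abs_square_less_1)
  then have "(norm (blaschke a w))\<^sup>2 < 1"
    using blaschke_defect[OF assms] by simp
  then show ?thesis
    by (simp add: abs_square_less_1)
qed

lemma blaschke_involution:
  assumes "norm a < 1" "norm w < 1"
  shows "blaschke a (blaschke a w) = w"
proof -
  have nz: "1 - cnj a * w \<noteq> 0" "1 - cnj a * a \<noteq> 0" 
    using blaschke_denominator_nonzero[of a w] blaschke_denominator_nonzero[of a a] assms by simp_all
  have n: "a - blaschke a w = w * (1 - cnj a * a) / (1 - cnj a * w)"
    using nz by (simp add: blaschke_def field_simps)
  have d: "1 - cnj a * blaschke a w = (1 - cnj a * a) / (1 - cnj a * w)"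
    using nz by (simp add: blaschke_def field_simps)
  show ?thesis
    unfolding blaschke_def[of a "blaschke a w"] n d using nz by simp
qed

lemma holomorphic_on_blaschke:
  assumes "F holomorphic_on S" "norm a < 1" "\<And>\<zeta>. \<zeta> \<in> S \<Longrightarrow> norm (F \<zeta>) < 1"
  shows "(\<lambda>\<zeta>. blaschke a (F \<zeta>)) holomorphic_on S"
  unfolding blaschke_def using assms blaschke_denominator_nonzero[of a]
  by (intro holomorphic_intros) (force simp: less_imp_le)+

text \<open>The Schwarz lemma bounds \<open>v = blaschke (F 0) (F \<zeta>)\<close> by \<open>\<zeta>\<close>; as \<open>F \<zeta> = blaschke (F 0) v\<close>, the formula for
  the defect \<open>1 - \<bar>F \<zeta>\<bar>\<^sup>2\<close> then bounds it from below. The denominator is estimated crudely by 4, because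
  only a bound below 1 that depends on \<open>\<bar>F 0\<bar>\<close> and \<open>\<bar>\<zeta>\<bar>\<close> alone is wanted.\<close>

lemma schwarz_pick_bound:
  assumes hol: "F holomorphic_on ball 0 1" and lt: "\<And>\<zeta>. norm \<zeta> < 1 \<Longrightarrow> norm (F \<zeta>) < 1"
    and \<zeta>: "norm \<zeta> < 1"
  shows "(norm (F \<zeta>))\<^sup>2 \<le> 1 - (1 - (norm (F 0))\<^sup>2) * (1 - (norm \<zeta>)\<^sup>2) / 4"
proof -
  let ?a = "F 0" and ?G = "\<lambda>\<zeta>. blaschke (F 0) (F \<zeta>)"
  have a: "norm ?a < 1"
    using lt[of 0] by simp
  have G: "norm (?G \<zeta>) \<le> norm \<zeta>"
  proof (rule Schwarz_Lemma(1))
    show "?G holomorphic_on ball 0 1"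
      using holomorphic_on_blaschke[OF hol a] lt by simp
  qed (use \<zeta> a lt norm_blaschke_less_1 in \<open>auto simp: blaschke_def\<close>)
  let ?v = "?G \<zeta>"
  have v: "norm ?v < 1"
    using G \<zeta> by simp
  have "norm (1 - cnj ?a * ?v) \<le> 1 + norm ?a * norm ?v"
    by (metis complex_mod_cnj norm_mult norm_one norm_triangle_ineq4)
  also have "\<dots> \<le> 1 + 1 * 1"
    using a v by (intro add_left_mono mult_mono) auto
  finally have le: "(norm (1 - cnj ?a * ?v))\<^sup>2 \<le> 4"
    using power_mono[of "norm (1 - cnj ?a * ?v)" 2 2] by simp
  have pos: "(norm (1 - cnj ?a * ?v))\<^sup>2 > 0"
    using blaschke_denominator_nonzero[of ?a ?v] a v by simp
  have sq: "(norm ?a)\<^sup>2 \<le> 1" "(norm ?v)\<^sup>2 \<le> (norm \<zeta>)\<^sup>2" "(norm \<zeta>)\<^sup>2 \<le> 1"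
    using a G \<zeta> by (auto simp: abs_square_le_1)
  moreover have "(norm ?v)\<^sup>2 \<le> 1"
    using v by (simp add: abs_square_le_1)
  ultimately have "(1 - (norm ?a)\<^sup>2) * (1 - (norm \<zeta>)\<^sup>2) / 4
        \<le> (1 - (norm ?a)\<^sup>2) * (1 - (norm ?v)\<^sup>2) / (norm (1 - cnj ?a * ?v))\<^sup>2"
    using le pos by (intro frac_le mult_mono mult_nonneg_nonneg) auto
  also have "\<dots> = 1 - (norm (F \<zeta>))\<^sup>2"
    using blaschke_defect[OF a v] blaschke_involution[OF a lt[OF \<zeta>]] by simp
  finally show ?thesis
    by simp
qed

section \<open>Holomorphic functions on complex discs in a domain\<close>

lemma norm_vector_scalar_mult:
  fixes v :: "complex ^ 'm"
  shows "norm (c *s v) = norm c * norm v"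
  by (simp add: norm_vec_def norm_mult L2_set_right_distrib)

lemma holomorphic_on_slice:
  fixes f :: "complex ^ 'm \<Rightarrow> complex"
  assumes f: "holomorphic_Cm f \<Omega>" and sub: "\<And>\<zeta>. norm \<zeta> < 1 \<Longrightarrow> x + \<zeta> *s v \<in> \<Omega>"
  shows "(\<lambda>\<zeta>. f (x + \<zeta> *s v)) holomorphic_on ball 0 1"
proof -
  have lin: "bounded_linear (\<lambda>\<zeta>::complex. \<zeta> *s v)"
    by (rule bounded_linear_intro[of _ "norm v"])
       (simp_all add: vec_eq_iff algebra_simps norm_vector_scalar_mult)
  have "(\<lambda>\<zeta>. f (x + \<zeta> *s v)) field_differentiable at \<zeta>" if \<zeta>: "norm \<zeta> < 1" for \<zeta>
  proof -
    obtain D where D: "(f has_derivative D) (at (x + \<zeta> *s v))" and Dc: "\<And>c u. D (c *s u) = c * D u"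
      using f sub[OF \<zeta>] unfolding holomorphic_Cm_def by blast
    have "((\<lambda>\<zeta>. x + \<zeta> *s v) has_derivative (\<lambda>\<zeta>. \<zeta> *s v)) (at \<zeta>)"
      by (auto intro!: derivative_eq_intros bounded_linear_imp_has_derivative[OF lin])
    then have "((\<lambda>\<zeta>. f (x + \<zeta> *s v)) has_derivative (\<lambda>\<zeta>. D (\<zeta> *s v))) (at \<zeta>)"
      using D by (rule has_derivative_compose)
    then have "((\<lambda>\<zeta>. f (x + \<zeta> *s v)) has_derivative (*) (D v)) (at \<zeta>)"
      unfolding Dc mult.commute[of _ "D v"] .
    then show ?thesis
      unfolding field_differentiable_def has_field_derivative_def by blast
  qed
  then show ?thesis
    by (simp add: holomorphic_on_open field_differentiable_def)
qed

text \<open>Nearby points of a domain are the centre and the point at parameter \<open>1/2\<close> of one complex disc inside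
  the domain. By connectedness, statements that propagate along such discs hold everywhere, which
  reduces questions in several variables to the unit disc.\<close>

lemma domain_slice_induct:
  fixes \<Omega> :: "(complex ^ 'm) set"
  assumes dom: "domain_Cm \<Omega>" and ab: "a \<in> \<Omega>" "b \<in> \<Omega>" and base: "P a"
    and step: "\<And>x v. (\<And>\<zeta>. norm \<zeta> < 1 \<Longrightarrow> x + \<zeta> *s v \<in> \<Omega>) \<Longrightarrow> P x \<Longrightarrow> P (x + (1/2) *s v)"
  shows "P b"
proof (rule connected_induction_simple[where S = \<Omega> and a = a and P = P])
  show "connected \<Omega>"
    using dom by (simp add: domain_Cm_def)
  fix c assume "c \<in> \<Omega>"
  then obtain R where R: "R > 0" "ball c R \<subseteq> \<Omega>"
    using dom by (auto simp: domain_Cm_def open_contains_ball)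
  \<comment> \<open>For \<open>x, y\<close> in this ball the disc \<open>x + 2 \<zeta> (y - x)\<close> stays within distance \<open>R/5 + 4R/5\<close> of \<open>c\<close>.\<close>
  define T where "T = ball c (R/5)"
  have "P y" if xy: "x \<in> T" "y \<in> T" and Px: "P x" for x y
  proof -
    have sub: "x + \<zeta> *s (2 *s (y - x)) \<in> \<Omega>" if \<zeta>: "norm \<zeta> < 1" for \<zeta>
    proof -
      have nx: "norm (x - c) < R/5" and ny: "norm (y - c) < R/5"
        using xy by (auto simp: T_def dist_norm norm_minus_commute)
      have "norm (y - x) \<le> norm (y - c) + norm (x - c)"
        using norm_triangle_ineq4[of "y - c" "x - c"] by simp
      then have nyx: "norm (y - x) \<le> 2 * (R/5)"
        using nx ny by simp
      have "norm (\<zeta> *s (2 *s (y - x))) \<le> 1 * (2 * norm (y - x))"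
        unfolding norm_vector_scalar_mult using \<zeta> by (intro mult_mono) auto
      then have "norm ((x - c) + \<zeta> *s (2 *s (y - x))) < R"
        using nx nyx norm_triangle_ineq[of "x - c" "\<zeta> *s (2 *s (y - x))"] by simp
      then have "x + \<zeta> *s (2 *s (y - x)) \<in> ball c R"
        by (simp add: dist_norm norm_minus_commute algebra_simps)
      then show ?thesis
        using R by blast
    qed
    have "x + (1/2) *s (2 *s (y - x)) = y"
      by (simp add: vec_eq_iff)
    then show "P y"
      using step[OF sub Px] by simp
  qed
  moreover have "openin (top_of_set \<Omega>) T"
    using R by (auto simp: T_def openin_open_eq dom[unfolded domain_Cm_def] intro: order_trans[OF subset_ball])
  moreover have "c \<in> T"
    using R by (simp add: T_def)
  ultimately show "\<exists>T. openin (top_of_set \<Omega>) T \<and> c \<in> T \<and> (\<forall>x\<in>T. \<forall>y\<in>T. P x \<longrightarrow> P y)"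
    by blast
qed (use ab base in auto)

text \<open>The maximum modulus principle on each disc propagates the extremal value.\<close>

lemma schur_class_unimodular_imp_constant:
  fixes g :: "complex ^ 'm \<Rightarrow> complex"
  assumes dom: "domain_Cm \<Omega>" and g: "g \<in> schur_class \<Omega>"
    and a: "a \<in> \<Omega>" "norm (g a) = 1" and b: "b \<in> \<Omega>"
  shows "g b = g a"
proof (rule domain_slice_induct[OF dom a(1) b])
  fix x v assume sub: "\<And>\<zeta>. norm \<zeta> < 1 \<Longrightarrow> x + \<zeta> *s v \<in> \<Omega>" and eq: "g x = g a"
  let ?F = "\<lambda>\<zeta>. g (x + \<zeta> *s v)"
  have x: "?F 0 = g x"
    by simp
  have "?F constant_on ball 0 1"
  proof (rule maximum_modulus_principle[where U = "ball 0 1" and \<xi> = 0])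
    show "?F holomorphic_on ball 0 1"
      using g sub by (intro holomorphic_on_slice[of g \<Omega>]) (auto simp: schur_class_def)
    show "norm (?F z) \<le> norm (?F 0)" if "z \<in> ball 0 1" for z
      unfolding x using that sub[of z] g eq a by (simp add: schur_class_def)
  qed auto
  moreover have "1/2 \<in> ball (0::complex) 1"
    by (simp add: norm_divide)
  ultimately have "?F (1/2) = ?F 0"
    unfolding constant_on_def by (metis centre_in_ball zero_less_one)
  then show "g (x + (1/2) *s v) = g a"
    using x eq by simp
qed simp

section \<open>The test functions\<close>

lemma Psi_blaschke: "Psi \<Omega> w0 = {\<lambda>z\<in>\<Omega>. blaschke (f w0) (f z) | f. f \<in> schur_class \<Omega> \<and> f ` \<Omega> \<subseteq> ball 0 1}"
  by (simp add: Psi_def blaschke_def)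

text \<open>All test functions vanish at \<open>w0\<close>, and by Schwarz-Pick a uniform defect \<open>\<delta>\<close> at the centre of a disc
  leaves the uniform defect \<open>\<delta> (1 - 1/4) / 4\<close> at its parameter \<open>1/2\<close>. The defect may depend on \<open>z\<close>, but
  not on the test function.\<close>

lemma Psi_uniformly_bounded:
  fixes \<Omega> :: "(complex ^ 'm) set"
  assumes dom: "domain_Cm \<Omega>" and w0: "w0 \<in> \<Omega>" and z: "z \<in> \<Omega>"
  obtains t where "0 \<le> t" "t < 1" "\<And>\<psi>. \<psi> \<in> Psi \<Omega> w0 \<Longrightarrow> norm (\<psi> z) \<le> t"
proof -
  define P where "P z \<longleftrightarrow> (\<exists>\<delta>>0. \<forall>\<psi>\<in>Psi \<Omega> w0. (norm (\<psi> z))\<^sup>2 \<le> 1 - \<delta>)" for z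
  have "P z"
  proof (rule domain_slice_induct[OF dom w0 z])
    show "P w0"
      unfolding P_def Psi_blaschke using w0 by (intro exI[of _ 1]) (auto simp: blaschke_def)
  next
    fix x v assume sub: "\<And>\<zeta>. norm \<zeta> < 1 \<Longrightarrow> x + \<zeta> *s v \<in> \<Omega>" and "P x"
    then obtain \<delta> where \<delta>: "\<delta> > 0" "\<And>\<psi>. \<psi> \<in> Psi \<Omega> w0 \<Longrightarrow> (norm (\<psi> x))\<^sup>2 \<le> 1 - \<delta>"
      unfolding P_def by blast
    have "(norm (\<psi> (x + (1/2) *s v)))\<^sup>2 \<le> 1 - \<delta> * 3 / 16" if \<psi>: "\<psi> \<in> Psi \<Omega> w0" for \<psi>
    proof -
      obtain f where f: "f \<in> schur_class \<Omega>" "f ` \<Omega> \<subseteq> ball 0 1"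
        and \<psi>f: "\<psi> = (\<lambda>z\<in>\<Omega>. blaschke (f w0) (f z))"
        using \<psi> unfolding Psi_blaschke by blast
      have fw: "norm (f w0) < 1"
        using f(2) w0 by force
      have f1: "norm (f (x + \<zeta> *s v)) < 1" if "norm \<zeta> < 1" for \<zeta>
        using f(2) sub[OF that] by force
      let ?F = "\<lambda>\<zeta>. blaschke (f w0) (f (x + \<zeta> *s v))"
      have "(\<lambda>\<zeta>. f (x + \<zeta> *s v)) holomorphic_on ball 0 1"
        using f sub by (intro holomorphic_on_slice[of f \<Omega>]) (auto simp: schur_class_def)
      then have hol: "?F holomorphic_on ball 0 1"
        using fw f1 by (intro holomorphic_on_blaschke) auto
      have half: "norm (1/2::complex) < 1"
        by (simp add: norm_divide)
      have F0: "(norm (?F 0))\<^sup>2 \<le> 1 - \<delta>"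
        using \<delta>(2)[OF \<psi>] sub[of 0] by (simp add: \<psi>f)
      have "(norm (?F (1/2)))\<^sup>2 \<le> 1 - (1 - (norm (?F 0))\<^sup>2) * (1 - (norm (1/2::complex))\<^sup>2) / 4"
        using fw f1 by (intro schwarz_pick_bound[OF hol _ half] norm_blaschke_less_1)
      also have "\<dots> \<le> 1 - \<delta> * 3 / 16"
        using F0 by (simp add: norm_divide power_divide)
      finally show ?thesis
        using sub[OF half] by (simp add: \<psi>f)
    qed
    then show "P (x + (1/2) *s v)"
      unfolding P_def using \<delta>(1) by (intro exI[of _ "\<delta> * 3 / 16"]) auto
  qed
  then obtain \<delta> where \<delta>: "\<delta> > 0" "\<And>\<psi>. \<psi> \<in> Psi \<Omega> w0 \<Longrightarrow> (norm (\<psi> z))\<^sup>2 \<le> 1 - \<delta>"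
    unfolding P_def by blast
  show ?thesis
  proof (rule that[of "sqrt (max 0 (1 - \<delta>))"])
    show "norm (\<psi> z) \<le> sqrt (max 0 (1 - \<delta>))" if "\<psi> \<in> Psi \<Omega> w0" for \<psi>
      using \<delta>(2)[OF that] by (intro real_le_rsqrt) simp
  qed (use \<delta>(1) in \<open>auto simp: max_def\<close>)
qed

lemma gen_algebra_prod:
  assumes "finite I" "\<And>i. i \<in> I \<Longrightarrow> f i \<in> gen_algebra F S"
  shows "(\<lambda>z\<in>F. \<Prod>i\<in>I. f i z) \<in> gen_algebra F S"
  using assms
proof (induction rule: finite_induct)
  case empty
  then show ?case
    by (simp only: prod.empty gen_algebra.const)
next
  case (insert j I)
  then have "(\<lambda>z\<in>F. f j z * (\<lambda>z\<in>F. \<Prod>i\<in>I. f i z) z) \<in> gen_algebra F S"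
    by (intro gen_algebra.mult) auto
  also have "(\<lambda>z\<in>F. f j z * (\<lambda>z\<in>F. \<Prod>i\<in>I. f i z) z) = (\<lambda>z\<in>F. \<Prod>i\<in>insert j I. f i z)"
    using insert.hyps by (intro restrict_ext) simp
  finally show ?case .
qed

lemma gen_algebra_sum:
  assumes "finite I" "\<And>i. i \<in> I \<Longrightarrow> f i \<in> gen_algebra F S"
  shows "(\<lambda>z\<in>F. \<Sum>i\<in>I. f i z) \<in> gen_algebra F S"
  using assms
proof (induction rule: finite_induct)
  case empty
  then show ?case
    by (simp only: sum.empty gen_algebra.const)
next
  case (insert j I)
  then have "(\<lambda>z\<in>F. f j z + (\<lambda>z\<in>F. \<Sum>i\<in>I. f i z) z) \<in> gen_algebra F S"
    by (intro gen_algebra.add) auto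
  also have "(\<lambda>z\<in>F. f j z + (\<lambda>z\<in>F. \<Sum>i\<in>I. f i z) z) = (\<lambda>z\<in>F. \<Sum>i\<in>insert j I. f i z)"
    using insert.hyps by (intro restrict_ext) simp
  finally show ?case .
qed

lemma gen_algebra_affine:
  assumes "g \<in> S"
  shows "(\<lambda>z\<in>F. (g z - a) / c) \<in> gen_algebra F S"
proof -
  have "(\<lambda>z\<in>F. (\<lambda>z\<in>F. restrict g F z + (\<lambda>z\<in>F. - a) z) z * (\<lambda>z\<in>F. 1 / c) z) \<in> gen_algebra F S"
    by (intro gen_algebra.mult gen_algebra.add gen_algebra.gen gen_algebra.const assms)
  then show ?thesis
    by (simp cong: restrict_cong)
qed

text \<open>Lagrange interpolation, with a separate separating function for each pair of nodes.\<close>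

lemma gen_algebra_separating:
  assumes F: "finite F" and sep: "\<And>z w. \<lbrakk>z \<in> F; w \<in> F; z \<noteq> w\<rbrakk> \<Longrightarrow> \<exists>g\<in>S. g z \<noteq> g w"
  shows "gen_algebra F S = (F \<rightarrow>\<^sub>E UNIV)"
proof
  show "gen_algebra F S \<subseteq> (F \<rightarrow>\<^sub>E UNIV)"
  proof
    fix f assume "f \<in> gen_algebra F S"
    then show "f \<in> F \<rightarrow>\<^sub>E UNIV"
      by cases auto
  qed
  show "(F \<rightarrow>\<^sub>E UNIV) \<subseteq> gen_algebra F S"
  proof
    fix \<phi> :: "'a \<Rightarrow> complex" assume \<phi>: "\<phi> \<in> F \<rightarrow>\<^sub>E UNIV"
    have "\<forall>z\<in>F. \<forall>w\<in>F - {z}. \<exists>g. g \<in> S \<and> g z \<noteq> g w"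
      using sep by blast
    then obtain g where g: "\<And>z w. \<lbrakk>z \<in> F; w \<in> F; z \<noteq> w\<rbrakk> \<Longrightarrow> g z w \<in> S \<and> g z w z \<noteq> g z w w"
      by (metis DiffI singletonD)
    define L where "L w = (\<lambda>x\<in>F. \<Prod>z\<in>F - {w}. (\<lambda>x\<in>F. (g w z x - g w z z) / (g w z w - g w z z)) x)" for w
    have LA: "L w \<in> gen_algebra F S" if "w \<in> F" for w
      unfolding L_def using F g that by (intro gen_algebra_prod gen_algebra_affine) auto
    have L: "L w x = (if x = w then 1 else 0)" if "w \<in> F" "x \<in> F" for w x
    proof (cases "x = w")
      case True
      then show ?thesis
        using that g[of w] by (simp add: L_def) (force intro!: prod.neutral)
    next
      case False
      then show ?thesis
        using that F by (auto simp: L_def intro!: prod_zero bexI[of _ x])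
    qed
    have "(\<lambda>x\<in>F. \<Sum>w\<in>F. (\<lambda>x\<in>F. (\<lambda>x\<in>F. \<phi> w) x * L w x) x) \<in> gen_algebra F S"
      using F LA by (intro gen_algebra_sum gen_algebra.mult gen_algebra.const) auto
    also have "(\<lambda>x\<in>F. \<Sum>w\<in>F. (\<lambda>x\<in>F. (\<lambda>x\<in>F. \<phi> w) x * L w x) x) = \<phi>"
    proof
      fix x
      show "(\<lambda>x\<in>F. \<Sum>w\<in>F. (\<lambda>x\<in>F. (\<lambda>x\<in>F. \<phi> w) x * L w x) x) x = \<phi> x"
        using \<phi> F by (cases "x \<in> F") (auto simp: L sum.remove[of F x] intro!: sum.neutral split: if_splits)
    qed
    finally show "\<phi> \<in> gen_algebra F S" .
  qed
qed

lemma holomorphic_Cm_compose_field: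
  assumes "holomorphic_Cm f \<Omega>" "\<And>z. z \<in> \<Omega> \<Longrightarrow> (k has_field_derivative k' (f z)) (at (f z))"
  shows "holomorphic_Cm (\<lambda>z. k (f z)) \<Omega>"
  unfolding holomorphic_Cm_def
proof
  fix z assume z: "z \<in> \<Omega>"
  then obtain D where D: "(f has_derivative D) (at z)" "\<And>c v. D (c *s v) = c * D v"
    using assms(1) unfolding holomorphic_Cm_def by blast
  have "((\<lambda>z. k (f z)) has_derivative (\<lambda>v. k' (f z) * D v)) (at z)"
    using has_derivative_compose[OF D(1) assms(2)[OF z, unfolded has_field_derivative_def]] .
  moreover have "k' (f z) * D (c *s v) = c * (k' (f z) * D v)" for c v
    by (simp add: D(2))
  ultimately show "\<exists>D. ((\<lambda>z. k (f z)) has_derivative D) (at z) \<and> (\<forall>c v. D (c *s v) = c * D v)"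
    by blast
qed

text \<open>A bounded function that separates two points still does so after rescaling into the disc, and disc
  automorphisms are injective.\<close>

lemma Psi_separates:
  fixes \<Omega> :: "(complex ^ 'm) set"
  assumes hyp: "caratheodory_hyperbolic \<Omega>" and pts: "w0 \<in> \<Omega>" "z \<in> \<Omega>" "w \<in> \<Omega>" "z \<noteq> w"
  shows "\<exists>\<psi>\<in>Psi \<Omega> w0. \<psi> z \<noteq> \<psi> w"
proof -
  obtain f where f: "holomorphic_Cm f \<Omega>" "bounded (f ` \<Omega>)" "f z \<noteq> f w"
    using hyp pts unfolding caratheodory_hyperbolic_def by blast
  obtain B where B: "B > 0" "\<And>x. x \<in> \<Omega> \<Longrightarrow> norm (f x) \<le> B"
    using f(2) by (auto simp: bounded_pos)
  define g where "g x = f x / (2 * of_real B)" for x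
  have "holomorphic_Cm g \<Omega>"
    unfolding g_def
    by (rule holomorphic_Cm_compose_field[OF f(1), where k' = "\<lambda>_. 1 / (2 * of_real B)"])
       (rule DERIV_cdivide[OF DERIV_ident])
  moreover have g1: "norm (g x) < 1" if "x \<in> \<Omega>" for x
    using B(1) B(2)[OF that] by (simp add: g_def norm_divide norm_mult field_simps)
  ultimately have "(\<lambda>x\<in>\<Omega>. blaschke (g w0) (g x)) \<in> Psi \<Omega> w0"
    unfolding Psi_blaschke schur_class_def by (force simp: less_imp_le)
  moreover have "blaschke (g w0) (g z) \<noteq> blaschke (g w0) (g w)"
  proof
    assume "blaschke (g w0) (g z) = blaschke (g w0) (g w)"
    then have "g z = g w"
      using blaschke_involution g1 pts by metis
    then show False
      using f(3) B(1) by (simp add: g_def)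
  qed
  ultimately show ?thesis
    using pts by (intro bexI[of _ "\<lambda>x\<in>\<Omega>. blaschke (g w0) (g x)"]) simp_all
qed

lemma test_functions_Psi:
  fixes \<Omega> :: "(complex ^ 'm) set"
  assumes "domain_Cm \<Omega>" "caratheodory_hyperbolic \<Omega>" "w0 \<in> \<Omega>"
  shows "test_functions \<Omega> (Psi \<Omega> w0)"
  unfolding test_functions_def
proof (intro conjI ballI allI impI)
  fix z assume "z \<in> \<Omega>"
  then obtain t where t: "t < 1" "\<And>\<psi>. \<psi> \<in> Psi \<Omega> w0 \<Longrightarrow> norm (\<psi> z) \<le> t"
    using Psi_uniformly_bounded[OF assms(1,3)] by metis
  have "(SUP \<psi>\<in>Psi \<Omega> w0. ereal (norm (\<psi> z))) \<le> ereal t"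
    using t(2) by (intro SUP_least) simp
  also have "\<dots> < 1"
    using t(1) by simp
  finally show "(SUP \<psi>\<in>Psi \<Omega> w0. ereal (norm (\<psi> z))) < 1" .
next
  fix F assume "finite F \<and> F \<subseteq> \<Omega>"
  then show "gen_algebra F (Psi \<Omega> w0) = (F \<rightarrow>\<^sub>E UNIV)"
    using Psi_separates[OF assms(2,3)] by (intro gen_algebra_separating) blast+
qed

section \<open>The algebra of bounded continuous functions\<close>

lemma Cb_iff:
  "a \<in> Cb Y \<longleftrightarrow> a \<in> extensional (topspace Y) \<and> bounded (a ` topspace Y) \<and> continuous_map Y euclidean a"
proof -
  have "Metric_space.mbounded UNIV dist S \<longleftrightarrow> bounded S" for S :: "complex set"
    by (auto simp: Met_TC.mbounded_def bounded_subset_cball Met_TC.mcball_def mball_eq_ball)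
  then show ?thesis
    by (auto simp: Cb_def)
qed

lemma Cb_compose:
  assumes a: "a \<in> Cb Y" and g: "continuous_on UNIV g"
  shows "(\<lambda>t\<in>topspace Y. g (a t)) \<in> Cb Y"
  unfolding Cb_iff
proof (intro conjI)
  have "compact (closure (a ` topspace Y))"
    using a by (simp add: Cb_iff compact_closure)
  then have "bounded (g ` closure (a ` topspace Y))"
    using g by (intro compact_imp_bounded compact_continuous_image) (auto intro: continuous_on_subset)
  then show "bounded ((\<lambda>t\<in>topspace Y. g (a t)) ` topspace Y)"
    by (rule bounded_subset) (use closure_subset in fastforce)
  have "continuous_map Y euclidean (g \<circ> a)"
    using a g by (intro continuous_map_compose[of _ euclidean]) (auto simp: Cb_iff)
  then show "continuous_map Y euclidean (\<lambda>t\<in>topspace Y. g (a t))"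
    by (rule continuous_map_eq) simp
qed simp

lemma Cb_star_in_Cb: "a \<in> Cb Y \<Longrightarrow> Cb_star Y a \<in> Cb Y"
  unfolding Cb_star_def by (rule Cb_compose) (auto intro: continuous_intros)

section \<open>Hilbert spaces with an explicit carrier\<close>

lemma (in Metric_space) contraction_has_fixed_point:
  assumes complete: mcomplete and x: "x \<in> M" and F: "F \<in> M \<rightarrow> M"
    and q: "0 \<le> q" "q < 1" and contr: "\<And>x y. \<lbrakk>x \<in> M; y \<in> M\<rbrakk> \<Longrightarrow> d (F x) (F y) \<le> q * d x y"
  shows "\<exists>y\<in>M. F y = y"
proof -
  define \<sigma> where "\<sigma> n = (F ^^ n) x" for n
  have Suc: "\<sigma> (Suc n) = F (\<sigma> n)" for n
    by (simp add: \<sigma>_def)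
  have M: "\<sigma> n \<in> M" for n
    using x F by (induction n) (auto simp: \<sigma>_def)
  \<comment> \<open>\<open>K\<close> is the sum of the geometric series that bounds the distance of the orbit from its start; it is
    characterized by \<open>d x (F x) + q K = K\<close>.\<close>
  define K where "K = d x (F x) / (1 - q)"
  have K: "0 \<le> K" "d x (F x) + q * K = K"
    using q by (simp_all add: K_def field_simps)
  have far: "d (\<sigma> 0) (\<sigma> k) \<le> K" for k
  proof (induction k)
    case 0
    then show ?case
      using K(1) M by simp
  next
    case (Suc k)
    have "d (\<sigma> 0) (\<sigma> (Suc k)) \<le> d (\<sigma> 0) (\<sigma> 1) + d (\<sigma> 1) (\<sigma> (Suc k))"
      using M by (intro triangle)
    also have "d (\<sigma> 0) (\<sigma> 1) = d x (F x)"
      by (simp add: \<sigma>_def)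
    also have "d (\<sigma> 1) (\<sigma> (Suc k)) \<le> q * d (\<sigma> 0) (\<sigma> k)"
      using contr[OF M M, of 0 k] by (simp add: \<open>\<And>n. \<sigma> (Suc n) = F (\<sigma> n)\<close>)
    also have "q * d (\<sigma> 0) (\<sigma> k) \<le> q * K"
      using q Suc.IH by (intro mult_left_mono)
    finally show ?case
      using K(2) by simp
  qed
  have near: "d (\<sigma> n) (\<sigma> (n + k)) \<le> q ^ n * K" for n k
  proof (induction n)
    case (Suc n)
    have "d (\<sigma> (Suc n)) (\<sigma> (Suc n + k)) \<le> q * d (\<sigma> n) (\<sigma> (n + k))"
      using contr[OF M M, of n "n + k"] by (simp add: \<open>\<And>n. \<sigma> (Suc n) = F (\<sigma> n)\<close>)
    also have "\<dots> \<le> q * (q ^ n * K)"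
      using q Suc by (intro mult_left_mono)
    finally show ?case
      by simp
  qed (use far in simp)
  have "MCauchy \<sigma>"
    unfolding MCauchy_def
  proof (intro conjI allI impI)
    show "range \<sigma> \<subseteq> M"
      using M by blast
    fix \<epsilon> :: real assume "\<epsilon> > 0"
    have "(\<lambda>n. q ^ n * K) \<longlonglongrightarrow> 0"
      using q by (intro tendsto_mult_left_zero LIMSEQ_power_zero) auto
    then have "\<forall>\<^sub>F n in sequentially. q ^ n * K < \<epsilon>"
      using \<open>\<epsilon> > 0\<close> by (rule order_tendstoD)
    then obtain N where N: "\<And>n. n \<ge> N \<Longrightarrow> q ^ n * K < \<epsilon>"
      by (auto simp: eventually_sequentially)
    have "d (\<sigma> n) (\<sigma> n') < \<epsilon>" if "N \<le> n" "n \<le> n'" for n n'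
      using near[of n "n' - n"] N[OF that(1)] that by simp
    then show "\<exists>N. \<forall>n n'. N \<le> n \<longrightarrow> N \<le> n' \<longrightarrow> d (\<sigma> n) (\<sigma> n') < \<epsilon>"
      by (metis commute nle_le)
  qed
  then obtain y where y: "limitin mtopology \<sigma> y sequentially"
    using complete unfolding mcomplete_def by blast
  then have yM: "y \<in> M" and lim: "(\<lambda>n. d (\<sigma> n) y) \<longlonglongrightarrow> 0"
    by (auto simp: limitin_metric_dist_null)
  have "d (F y) y \<le> q * d (\<sigma> n) y + d (\<sigma> (Suc n)) y" for n
  proof -
    have "d (F y) y \<le> d (F y) (\<sigma> (Suc n)) + d (\<sigma> (Suc n)) y"
      using M yM F by (intro triangle) auto
    also have "d (F y) (\<sigma> (Suc n)) \<le> q * d (\<sigma> n) y"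
      using contr[OF yM M, of n] by (simp add: Suc commute)
    finally show ?thesis
      by simp
  qed
  moreover have "(\<lambda>n. q * d (\<sigma> n) y + d (\<sigma> (Suc n)) y) \<longlonglongrightarrow> q * 0 + 0"
    by (intro tendsto_intros lim LIMSEQ_Suc)
  ultimately have "d (F y) y \<le> 0"
    using LIMSEQ_le_const[of _ "q * 0 + 0" "d (F y) y"] by simp
  then have "F y = y"
    using F yM by (metis Pi_mem nonneg order_antisym zero)
  then show ?thesis
    using yM by blast
qed

context
  fixes H :: "('x, 'r) cinner_space_scheme"
  assumes hilbert: "hilbert_space H"
begin

lemma hilbert_module: "Module.module (ring_of_type_algebra :: complex ring) H"
  using hilbert unfolding hilbert_space_def by blast

lemma hilbert_abelian_group: "abelian_group H"
  using hilbert_module by (simp add: Module.module_def)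

interpretation abelian_group H
  by (rule hilbert_abelian_group)

lemma smult_closed: "x \<in> carrier H \<Longrightarrow> c \<odot>\<^bsub>H\<^esub> x \<in> carrier H"
  using Module.module.smult_closed[OF hilbert_module, of c x] by (simp add: ring_of_type_algebra_def)

lemma smult_add_right:
  "\<lbrakk>x \<in> carrier H; y \<in> carrier H\<rbrakk> \<Longrightarrow> c \<odot>\<^bsub>H\<^esub> (x \<oplus>\<^bsub>H\<^esub> y) = c \<odot>\<^bsub>H\<^esub> x \<oplus>\<^bsub>H\<^esub> c \<odot>\<^bsub>H\<^esub> y"
  using Module.module.smult_r_distr[OF hilbert_module, of c x y] by (simp add: ring_of_type_algebra_def)

lemma cinner_add_left:
  "\<lbrakk>x \<in> carrier H; y \<in> carrier H; z \<in> carrier H\<rbrakk> \<Longrightarrow>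
    cinner H (x \<oplus>\<^bsub>H\<^esub> y) z = cinner H x z + cinner H y z"
  using hilbert unfolding hilbert_space_def by blast

lemma cinner_smult_left:
  "\<lbrakk>x \<in> carrier H; y \<in> carrier H\<rbrakk> \<Longrightarrow> cinner H (c \<odot>\<^bsub>H\<^esub> x) y = c * cinner H x y"
  using hilbert unfolding hilbert_space_def by blast

lemma cinner_commute:
  "\<lbrakk>x \<in> carrier H; y \<in> carrier H\<rbrakk> \<Longrightarrow> cinner H y x = cnj (cinner H x y)"
  using hilbert unfolding hilbert_space_def by blast

lemma cinner_add_right:
  "\<lbrakk>x \<in> carrier H; y \<in> carrier H; z \<in> carrier H\<rbrakk> \<Longrightarrow>
    cinner H x (y \<oplus>\<^bsub>H\<^esub> z) = cinner H x y + cinner H x z"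
  by (metis a_closed cinner_add_left cinner_commute complex_cnj_add)

lemma cinner_smult_right:
  "\<lbrakk>x \<in> carrier H; y \<in> carrier H\<rbrakk> \<Longrightarrow> cinner H x (c \<odot>\<^bsub>H\<^esub> y) = cnj c * cinner H x y"
  by (metis cinner_smult_left cinner_commute complex_cnj_mult smult_closed)

lemma cinner_zero_left: "x \<in> carrier H \<Longrightarrow> cinner H \<zero>\<^bsub>H\<^esub> x = 0"
  using cinner_add_left[of "\<zero>\<^bsub>H\<^esub>" "\<zero>\<^bsub>H\<^esub>" x] by simp

lemma cinner_minus_left:
  "\<lbrakk>x \<in> carrier H; y \<in> carrier H\<rbrakk> \<Longrightarrow> cinner H (\<ominus>\<^bsub>H\<^esub> x) y = - cinner H x y"
  using cinner_add_left[of x "\<ominus>\<^bsub>H\<^esub> x" y] by (simp add: r_neg cinner_zero_left eq_neg_iff_add_eq_0 add.commute)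

lemma Re_cinner_self_nonneg: "x \<in> carrier H \<Longrightarrow> 0 \<le> Re (cinner H x x)"
  using hilbert unfolding hilbert_space_def by blast

lemma hnorm_square: "x \<in> carrier H \<Longrightarrow> (hnorm H x)\<^sup>2 = Re (cinner H x x)"
  by (simp add: hnorm_def Re_cinner_self_nonneg)

lemma hnorm_nonneg: "x \<in> carrier H \<Longrightarrow> 0 \<le> hnorm H x"
  by (simp add: hnorm_def Re_cinner_self_nonneg)

lemma hnorm_zero_iff: "x \<in> carrier H \<Longrightarrow> hnorm H x = 0 \<longleftrightarrow> x = \<zero>\<^bsub>H\<^esub>"
proof
  assume x: "x \<in> carrier H" and "hnorm H x = 0"
  then have "Re (cinner H x x) = 0"
    by (simp flip: hnorm_square)
  moreover have "Im (cinner H x x) = 0"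
    using cinner_commute[OF x x] by (metis add_cancel_right_right cnj.simps(2) eq_neg_iff_add_eq_0 mult_2 mult_eq_0_iff zero_neq_numeral)
  ultimately have "cinner H x x = 0"
    by (simp add: complex_eq_iff)
  then show "x = \<zero>\<^bsub>H\<^esub>"
    using hilbert x unfolding hilbert_space_def by blast
qed (simp add: hnorm_def cinner_zero_left)

lemma cinner_minus_right:
  "\<lbrakk>x \<in> carrier H; y \<in> carrier H\<rbrakk> \<Longrightarrow> cinner H x (\<ominus>\<^bsub>H\<^esub> y) = - cinner H x y"
  by (metis a_inv_closed cinner_commute cinner_minus_left complex_cnj_minus)

lemma hnorm_uminus: "x \<in> carrier H \<Longrightarrow> hnorm H (\<ominus>\<^bsub>H\<^esub> x) = hnorm H x"
  by (simp add: hnorm_def cinner_minus_left cinner_minus_right)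

lemma hnorm_add_square:
  assumes "x \<in> carrier H" "y \<in> carrier H"
  shows "(hnorm H (x \<oplus>\<^bsub>H\<^esub> y))\<^sup>2 = (hnorm H x)\<^sup>2 + 2 * Re (cinner H x y) + (hnorm H y)\<^sup>2"
  using assms cinner_commute[OF assms]
  by (simp add: hnorm_square cinner_add_left cinner_add_right)

text \<open>The real part of the Cauchy-Schwarz inequality, which is what the triangle inequality needs.\<close>

lemma Re_cinner_le:
  assumes x: "x \<in> carrier H" and y: "y \<in> carrier H"
  shows "Re (cinner H x y) \<le> hnorm H x * hnorm H y"
proof (cases "y = \<zero>\<^bsub>H\<^esub>")
  case True
  then show ?thesis
    using x cinner_commute[of "\<zero>\<^bsub>H\<^esub>" x] hnorm_zero_iff[OF y] by (simp add: cinner_zero_left)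
next
  case False
  define c where "c = Re (cinner H x y)"
  define n where "n = (hnorm H y)\<^sup>2"
  have n: "n > 0"
    using False hnorm_zero_iff[OF y] by (simp add: n_def)
  \<comment> \<open>The real multiple of \<open>y\<close> that minimizes the norm of \<open>x + s y\<close>.\<close>
  define s where "s = complex_of_real (- c / n)"
  have "0 \<le> (hnorm H (x \<oplus>\<^bsub>H\<^esub> s \<odot>\<^bsub>H\<^esub> y))\<^sup>2"
    by simp
  also have "\<dots> = (hnorm H x)\<^sup>2 + 2 * Re (cinner H x (s \<odot>\<^bsub>H\<^esub> y)) + (hnorm H (s \<odot>\<^bsub>H\<^esub> y))\<^sup>2"
    using x y by (intro hnorm_add_square smult_closed)
  also have "Re (cinner H x (s \<odot>\<^bsub>H\<^esub> y)) = - c / n * c"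
    using x y by (simp add: cinner_smult_right s_def c_def)
  also have "(hnorm H (s \<odot>\<^bsub>H\<^esub> y))\<^sup>2 = (- c / n) * (- c / n) * n"
    using x y by (simp add: hnorm_square smult_closed cinner_smult_left cinner_smult_right s_def n_def
        flip: of_real_mult)
  also have "(- c / n) * (- c / n) * n = c * c / n"
    using n by simp
  finally have "c * c / n \<le> (hnorm H x)\<^sup>2"
    by (simp add: field_simps)
  then have "c\<^sup>2 \<le> (hnorm H x * hnorm H y)\<^sup>2"
    using n by (simp add: field_simps power2_eq_square n_def)
  then show ?thesis
    unfolding c_def[symmetric] using x y by (intro power2_le_imp_le[of c]) (auto simp: hnorm_nonneg)
qed

lemma hnorm_triangle:
  assumes x: "x \<in> carrier H" and y: "y \<in> carrier H"
  shows "hnorm H (x \<oplus>\<^bsub>H\<^esub> y) \<le> hnorm H x + hnorm H y"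
proof (rule power2_le_imp_le)
  show "(hnorm H (x \<oplus>\<^bsub>H\<^esub> y))\<^sup>2 \<le> (hnorm H x + hnorm H y)\<^sup>2"
    using Re_cinner_le[OF x y] unfolding hnorm_add_square[OF x y] power2_sum by simp
qed (use x y hnorm_nonneg in simp)

lemma Metric_space_hdist: "Metric_space (carrier H) (hdist H)"
proof
  show "0 \<le> hdist H x y" for x y
    by (simp add: hdist_def hnorm_nonneg)
  show "hdist H x y = hdist H y x" for x y
  proof (cases "x \<in> carrier H \<and> y \<in> carrier H")
    case True
    then have "y \<ominus>\<^bsub>H\<^esub> x = \<ominus>\<^bsub>H\<^esub> (x \<ominus>\<^bsub>H\<^esub> y)"
      by (simp add: a_minus_def minus_add a_comm)
    then show ?thesis
      using True by (simp add: hdist_def hnorm_uminus)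
  qed (auto simp: hdist_def)
  show "hdist H x y = 0 \<longleftrightarrow> x = y" if "x \<in> carrier H" "y \<in> carrier H" for x y
  proof -
    have "x = (x \<ominus>\<^bsub>H\<^esub> y) \<oplus>\<^bsub>H\<^esub> y"
      using that by (simp add: a_minus_def a_assoc l_neg)
    then have "x \<ominus>\<^bsub>H\<^esub> y = \<zero>\<^bsub>H\<^esub> \<longleftrightarrow> x = y"
      using that by (metis a_minus_def l_zero r_neg)
    then show ?thesis
      using that by (simp add: hdist_def hnorm_zero_iff)
  qed
  show "hdist H x z \<le> hdist H x y + hdist H y z"
    if "x \<in> carrier H" "y \<in> carrier H" "z \<in> carrier H" for x y z
  proof -
    have "x \<ominus>\<^bsub>H\<^esub> z = (x \<ominus>\<^bsub>H\<^esub> y) \<oplus>\<^bsub>H\<^esub> (y \<ominus>\<^bsub>H\<^esub> z)"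
      using that by (simp add: a_minus_def a_assoc r_neg1 r_neg2)
    then show ?thesis
      using that hnorm_triangle[of "x \<ominus>\<^bsub>H\<^esub> y" "y \<ominus>\<^bsub>H\<^esub> z"] by (simp add: hdist_def)
  qed
qed

section \<open>Resolvents of strict contractions\<close>

text \<open>The inverse \<open>S\<close> of \<open>1 - T\<close> is built pointwise: \<open>S u\<close> is the unique fixed point of the contraction
  \<open>v \<mapsto> u + T v\<close>. Uniqueness makes \<open>S\<close> linear, and \<open>\<parallel>S u\<parallel> \<le> \<parallel>u\<parallel> + q \<parallel>S u\<parallel>\<close> makes it bounded. This existence
  is what gives the choice in \<^const>\<open>op_inverse\<close> a meaning; the conclusion records its value by the
  fixed-point equation.\<close>

lemma op_inverse_contraction:
  assumes T: "T \<in> carrier H \<rightarrow> carrier H"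
    and add: "\<And>x y. \<lbrakk>x \<in> carrier H; y \<in> carrier H\<rbrakk> \<Longrightarrow> T (x \<oplus>\<^bsub>H\<^esub> y) = T x \<oplus>\<^bsub>H\<^esub> T y"
    and scale: "\<And>c x. x \<in> carrier H \<Longrightarrow> T (c \<odot>\<^bsub>H\<^esub> x) = c \<odot>\<^bsub>H\<^esub> T x"
    and q: "0 \<le> q" "q < 1" and contr: "\<And>x. x \<in> carrier H \<Longrightarrow> hnorm H (T x) \<le> q * hnorm H x"
    and x: "x \<in> carrier H"
  defines "y \<equiv> op_inverse H (\<lambda>v. v \<ominus>\<^bsub>H\<^esub> T v) x"
  shows "y \<in> carrier H" and "y = x \<oplus>\<^bsub>H\<^esub> T y"
proof -
  interpret Metric_space "carrier H" "hdist H"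
    by (rule Metric_space_hdist)
  have Tc [simp]: "T u \<in> carrier H" if "u \<in> carrier H" for u
    using T that by blast
  have neg: "T (\<ominus>\<^bsub>H\<^esub> u) = \<ominus>\<^bsub>H\<^esub> T u" if "u \<in> carrier H" for u
  proof -
    have "T \<zero>\<^bsub>H\<^esub> = \<zero>\<^bsub>H\<^esub>"
      using add[of "\<zero>\<^bsub>H\<^esub>" "\<zero>\<^bsub>H\<^esub>"] by (metis Tc add.l_cancel_one' zero_closed l_zero)
    then have "T (\<ominus>\<^bsub>H\<^esub> u) \<oplus>\<^bsub>H\<^esub> T u = \<zero>\<^bsub>H\<^esub>"
      using add[of "\<ominus>\<^bsub>H\<^esub> u" u] that by (simp add: l_neg)
    then show ?thesis
      using that by (simp add: minus_equality)
  qed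
  have shift: "hdist H (u \<oplus>\<^bsub>H\<^esub> T v) (u \<oplus>\<^bsub>H\<^esub> T w) \<le> q * hdist H v w"
    if "u \<in> carrier H" "v \<in> carrier H" "w \<in> carrier H" for u v w
  proof -
    have "(u \<oplus>\<^bsub>H\<^esub> T v) \<ominus>\<^bsub>H\<^esub> (u \<oplus>\<^bsub>H\<^esub> T w) = (u \<oplus>\<^bsub>H\<^esub> \<ominus>\<^bsub>H\<^esub> u) \<oplus>\<^bsub>H\<^esub> (T v \<oplus>\<^bsub>H\<^esub> \<ominus>\<^bsub>H\<^esub> T w)"
      using that by (simp add: a_minus_def minus_add a_ac)
    also have "\<dots> = T (v \<ominus>\<^bsub>H\<^esub> w)"
      using that by (simp add: a_minus_def add neg r_neg)
    finally have "(u \<oplus>\<^bsub>H\<^esub> T v) \<ominus>\<^bsub>H\<^esub> (u \<oplus>\<^bsub>H\<^esub> T w) = T (v \<ominus>\<^bsub>H\<^esub> w)" .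
    then show ?thesis
      using contr[of "v \<ominus>\<^bsub>H\<^esub> w"] that by (simp add: hdist_def)
  qed
  have ex: "\<exists>v\<in>carrier H. u \<oplus>\<^bsub>H\<^esub> T v = v" if u: "u \<in> carrier H" for u
  proof (rule contraction_has_fixed_point)
    show mcomplete
      using hilbert unfolding hilbert_space_def by blast
  qed (use u q shift in auto)
  have uniq: "v = w" if "u \<in> carrier H" "v \<in> carrier H" "w \<in> carrier H"
      "u \<oplus>\<^bsub>H\<^esub> T v = v" "u \<oplus>\<^bsub>H\<^esub> T w = w" for u v w
  proof -
    have "(1 - q) * hdist H v w \<le> 0"
      using shift[of u v w] that by (simp add: algebra_simps)
    then have "hdist H v w = 0"
      using q nonneg[of v w] by (simp add: mult_le_0_iff)
    then show ?thesis
      using that zero by simp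
  qed
  define S where "S u = (THE v. v \<in> carrier H \<and> u \<oplus>\<^bsub>H\<^esub> T v = v)" for u
  have SI: "S u = v" if "u \<in> carrier H" "v \<in> carrier H" "u \<oplus>\<^bsub>H\<^esub> T v = v" for u v
    unfolding S_def using that uniq by (intro the_equality) blast+
  have S: "S u \<in> carrier H" "u \<oplus>\<^bsub>H\<^esub> T (S u) = S u" if "u \<in> carrier H" for u
    using ex[OF that] SI[OF that] by auto
  have cancel: "(u \<oplus>\<^bsub>H\<^esub> v) \<ominus>\<^bsub>H\<^esub> v = u" "(u \<ominus>\<^bsub>H\<^esub> v) \<oplus>\<^bsub>H\<^esub> v = u"
    if "u \<in> carrier H" "v \<in> carrier H" for u v
    using that by (simp_all add: a_minus_def a_assoc r_neg l_neg)
  have "bounded_operator H S"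
    unfolding bounded_operator_def
  proof (intro conjI ballI allI)
    show "S \<in> carrier H \<rightarrow> carrier H"
      using S by blast
    show "S (u \<oplus>\<^bsub>H\<^esub> v) = S u \<oplus>\<^bsub>H\<^esub> S v" if "u \<in> carrier H" "v \<in> carrier H" for u v
    proof (rule SI)
      have "(u \<oplus>\<^bsub>H\<^esub> v) \<oplus>\<^bsub>H\<^esub> T (S u \<oplus>\<^bsub>H\<^esub> S v) = (u \<oplus>\<^bsub>H\<^esub> T (S u)) \<oplus>\<^bsub>H\<^esub> (v \<oplus>\<^bsub>H\<^esub> T (S v))"
        using that S(1) by (simp add: add a_ac)
      then show "(u \<oplus>\<^bsub>H\<^esub> v) \<oplus>\<^bsub>H\<^esub> T (S u \<oplus>\<^bsub>H\<^esub> S v) = S u \<oplus>\<^bsub>H\<^esub> S v"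
        using that S(2) by simp
    qed (use that S in auto)
    show "S (c \<odot>\<^bsub>H\<^esub> u) = c \<odot>\<^bsub>H\<^esub> S u" if "u \<in> carrier H" for c u
    proof (rule SI)
      have "c \<odot>\<^bsub>H\<^esub> u \<oplus>\<^bsub>H\<^esub> T (c \<odot>\<^bsub>H\<^esub> S u) = c \<odot>\<^bsub>H\<^esub> (u \<oplus>\<^bsub>H\<^esub> T (S u))"
        using that S(1) by (simp add: scale smult_add_right)
      then show "c \<odot>\<^bsub>H\<^esub> u \<oplus>\<^bsub>H\<^esub> T (c \<odot>\<^bsub>H\<^esub> S u) = c \<odot>\<^bsub>H\<^esub> S u"
        by (simp only: S(2)[OF that])
    qed (use that S smult_closed in auto)
    show "\<exists>K. \<forall>u\<in>carrier H. hnorm H (S u) \<le> K * hnorm H u"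
    proof (intro exI ballI)
      fix u assume u: "u \<in> carrier H"
      have "hnorm H (S u) \<le> hnorm H u + q * hnorm H (S u)"
        using hnorm_triangle[of u "T (S u)"] contr[of "S u"] S[OF u] u by simp
      then show "hnorm H (S u) \<le> 1 / (1 - q) * hnorm H u"
        using q by (simp add: field_simps)
    qed
  qed
  moreover have "is_inverse_op H (\<lambda>v. v \<ominus>\<^bsub>H\<^esub> T v) S"
    unfolding is_inverse_op_def
  proof (intro ballI conjI)
    fix u assume u: "u \<in> carrier H"
    show "S (u \<ominus>\<^bsub>H\<^esub> T u) = u"
      using u cancel(2) by (intro SI) auto
    show "S u \<ominus>\<^bsub>H\<^esub> T (S u) = u"
      using cancel(1)[OF u Tc[OF S(1)[OF u]]] S(2)[OF u] by simp
  qed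
  ultimately have "\<exists>S. bounded_operator H S \<and> is_inverse_op H (\<lambda>v. v \<ominus>\<^bsub>H\<^esub> T v) S"
    by blast
  then have inv: "bounded_operator H (op_inverse H (\<lambda>v. v \<ominus>\<^bsub>H\<^esub> T v)) \<and>
      is_inverse_op H (\<lambda>v. v \<ominus>\<^bsub>H\<^esub> T v) (op_inverse H (\<lambda>v. v \<ominus>\<^bsub>H\<^esub> T v))"
    unfolding op_inverse_def by (rule someI_ex)
  then show y: "y \<in> carrier H"
    unfolding y_def bounded_operator_def using x by blast
  have "y \<ominus>\<^bsub>H\<^esub> T y = x"
    using inv x unfolding y_def is_inverse_op_def by blast
  then show "y = x \<oplus>\<^bsub>H\<^esub> T y"
    using cancel(2)[OF y Tc[OF y]] by simp
qed

text \<open>With \<open>y = (1 - T)\<inverse> \<gamma>\<close> the inner product is \<open>\<langle>y - T y, y + T y\<rangle>\<close>, whose mixed terms are purely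
  imaginary together; its real part is \<open>\<parallel>y\<parallel>\<^sup>2 - \<parallel>T y\<parallel>\<^sup>2\<close>.\<close>

lemma Re_cinner_cayley_nonneg:
  assumes T: "T \<in> carrier H \<rightarrow> carrier H"
    and add: "\<And>x y. \<lbrakk>x \<in> carrier H; y \<in> carrier H\<rbrakk> \<Longrightarrow> T (x \<oplus>\<^bsub>H\<^esub> y) = T x \<oplus>\<^bsub>H\<^esub> T y"
    and scale: "\<And>c x. x \<in> carrier H \<Longrightarrow> T (c \<odot>\<^bsub>H\<^esub> x) = c \<odot>\<^bsub>H\<^esub> T x"
    and q: "0 \<le> q" "q < 1" and contr: "\<And>x. x \<in> carrier H \<Longrightarrow> hnorm H (T x) \<le> q * hnorm H x"
    and \<gamma>: "\<gamma> \<in> carrier H"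
  shows "0 \<le> Re (cinner H \<gamma> (cayley H T \<gamma>))"
proof -
  define y where "y = op_inverse H (\<lambda>v. v \<ominus>\<^bsub>H\<^esub> T v) \<gamma>"
  have y: "y \<in> carrier H" and eq: "y = \<gamma> \<oplus>\<^bsub>H\<^esub> T y"
    using op_inverse_contraction[OF T add scale q contr \<gamma>] by (simp_all add: y_def)
  have Ty: "T y \<in> carrier H"
    using T y by blast
  have yy: "cinner H y u = cinner H \<gamma> u + cinner H (T y) u" if "u \<in> carrier H" for u
    using cinner_add_left[OF \<gamma> Ty that] eq by simp
  have "cinner H \<gamma> (cayley H T \<gamma>) = cinner H \<gamma> y + cinner H \<gamma> (T y)"
    unfolding cayley_def Let_def y_def[symmetric] using \<gamma> y Ty by (simp add: cinner_add_right)
  also have "\<dots> = cinner H y y - cinner H (T y) y + (cinner H y (T y) - cinner H (T y) (T y))"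
    using yy[OF y] yy[OF Ty] by simp
  finally have "Re (cinner H \<gamma> (cayley H T \<gamma>)) = (hnorm H y)\<^sup>2 - (hnorm H (T y))\<^sup>2"
    using cinner_commute[OF y Ty] y Ty by (simp add: hnorm_square)
  moreover have "hnorm H (T y) \<le> hnorm H y"
    using contr[OF y] q hnorm_nonneg[OF y] mult_right_mono[of q 1 "hnorm H y"] by simp
  then have "(hnorm H (T y))\<^sup>2 \<le> (hnorm H y)\<^sup>2"
    using hnorm_nonneg[OF Ty] by (rule power_mono)
  ultimately show ?thesis
    by simp
qed

section \<open>Representations\<close>

lemma hnorm_unitary:
  assumes U: "unitary_operator H U" and x: "x \<in> carrier H"
  shows "hnorm H (U x) = hnorm H x"
proof -
  obtain V where V: "is_adjoint H U V" "is_inverse_op H U V"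
    using U unfolding unitary_operator_def by blast
  have "U x \<in> carrier H"
    using U x unfolding unitary_operator_def bounded_operator_def by blast
  then have "cinner H (U x) (U x) = cinner H x x"
    using V x by (simp add: is_adjoint_def is_inverse_op_def)
  then show ?thesis
    by (simp add: hnorm_def)
qed

text \<open>If \<open>\<bar>a\<bar> \<le> c\<close>, then \<open>c\<^sup>2 - \<bar>a\<bar>\<^sup>2\<close> is the square of a nonnegative function \<open>b\<close> of the algebra, and applying \<open>\<rho>\<close>
  to \<open>a* a + b* b = c\<^sup>2\<close> gives \<open>\<parallel>\<rho> a x\<parallel>\<^sup>2 + \<parallel>\<rho> b x\<parallel>\<^sup>2 = c\<^sup>2 \<parallel>x\<parallel>\<^sup>2\<close>.\<close>

lemma star_representation_contractive:
  assumes \<rho>: "unital_star_representation Y H \<rho>" and a: "a \<in> Cb Y"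
    and c: "0 \<le> c" "\<And>t. t \<in> topspace Y \<Longrightarrow> norm (a t) \<le> c" and x: "x \<in> carrier H"
  shows "hnorm H (\<rho> a x) \<le> c * hnorm H x"
proof -
  have closed: "\<rho> u v \<in> carrier H" if "u \<in> Cb Y" "v \<in> carrier H" for u v
    using \<rho> that unfolding unital_star_representation_def bounded_operator_def by blast
  have square: "cinner H (\<rho> u x) (\<rho> u x) = cinner H x (\<rho> (\<lambda>t\<in>topspace Y. cnj (u t) * u t) x)"
    if u: "u \<in> Cb Y" for u
  proof -
    have "cinner H (\<rho> u x) (\<rho> u x) = cinner H x (\<rho> (Cb_star Y u) (\<rho> u x))"
      using \<rho> u x closed[OF u x] unfolding unital_star_representation_def is_adjoint_def by blast
    also have "\<rho> (Cb_star Y u) (\<rho> u x) = \<rho> (\<lambda>t\<in>topspace Y. Cb_star Y u t * u t) x"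
      using \<rho> u x Cb_star_in_Cb[OF u] unfolding unital_star_representation_def by metis
    also have "(\<lambda>t\<in>topspace Y. Cb_star Y u t * u t) = (\<lambda>t\<in>topspace Y. cnj (u t) * u t)"
      by (auto simp: Cb_star_def)
    finally show ?thesis .
  qed
  have plus: "\<rho> (\<lambda>t\<in>topspace Y. u t + v t) x = \<rho> u x \<oplus>\<^bsub>H\<^esub> \<rho> v x" if "u \<in> Cb Y" "v \<in> Cb Y" for u v
    using \<rho> x that unfolding unital_star_representation_def by blast
  define b where "b = (\<lambda>t\<in>topspace Y. complex_of_real (sqrt (c\<^sup>2 - (norm (a t))\<^sup>2)))"
  have b: "b \<in> Cb Y"
    unfolding b_def using a by (rule Cb_compose) (intro continuous_intros)
  let ?aa = "\<lambda>t\<in>topspace Y. cnj (a t) * a t" and ?bb = "\<lambda>t\<in>topspace Y. cnj (b t) * b t"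
  have "continuous_on UNIV (\<lambda>w::complex. cnj w * w)"
    by (intro continuous_intros)
  then have aa: "?aa \<in> Cb Y" and bb: "?bb \<in> Cb Y"
    using Cb_compose a b by blast+
  have one: "(\<lambda>t\<in>topspace Y. 1) \<in> Cb Y"
    using Cb_compose[OF a, of "\<lambda>_. 1"] by simp
  have sum: "(\<lambda>t\<in>topspace Y. ?aa t + ?bb t) = (\<lambda>t\<in>topspace Y. of_real (c\<^sup>2) * (\<lambda>t\<in>topspace Y. 1) t)"
  proof (rule restrict_ext)
    fix t assume t: "t \<in> topspace Y"
    have "(norm (a t))\<^sup>2 \<le> c\<^sup>2"
      using c(2)[OF t] by (intro power_mono) auto
    then have "cnj (b t) * b t = of_real (c\<^sup>2 - (norm (a t))\<^sup>2)"
      using t by (simp add: b_def flip: of_real_mult)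
    moreover have "cnj (a t) * a t = of_real ((norm (a t))\<^sup>2)"
      by (metis complex_norm_square mult.commute)
    ultimately show "?aa t + ?bb t = of_real (c\<^sup>2) * (\<lambda>t\<in>topspace Y. 1) t"
      using t by simp
  qed
  have "cinner H (\<rho> a x) (\<rho> a x) + cinner H (\<rho> b x) (\<rho> b x) = cinner H x (\<rho> ?aa x \<oplus>\<^bsub>H\<^esub> \<rho> ?bb x)"
    using square[OF a] square[OF b] x closed aa bb by (simp add: cinner_add_right)
  also have "\<rho> ?aa x \<oplus>\<^bsub>H\<^esub> \<rho> ?bb x = \<rho> (\<lambda>t\<in>topspace Y. ?aa t + ?bb t) x"
    using plus[OF aa bb] by (rule sym)
  also have "\<dots> = of_real (c\<^sup>2) \<odot>\<^bsub>H\<^esub> \<rho> (\<lambda>t\<in>topspace Y. 1) x"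
    unfolding sum using \<rho> one x unfolding unital_star_representation_def by blast
  also have "\<rho> (\<lambda>t\<in>topspace Y. 1) x = x"
    using \<rho> x unfolding unital_star_representation_def by blast
  also have "cinner H x (of_real (c\<^sup>2) \<odot>\<^bsub>H\<^esub> x) = of_real (c\<^sup>2) * cinner H x x"
    using x by (simp add: cinner_smult_right)
  finally have "Re (cinner H (\<rho> a x) (\<rho> a x)) + Re (cinner H (\<rho> b x) (\<rho> b x)) = c\<^sup>2 * Re (cinner H x x)"
    by (simp only: complex_eq_iff plus_complex.sel times_complex.sel Re_complex_of_real Im_complex_of_real)
  then have "(hnorm H (\<rho> a x))\<^sup>2 + (hnorm H (\<rho> b x))\<^sup>2 = c\<^sup>2 * (hnorm H x)\<^sup>2"
    using hnorm_square closed a b x by simp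
  moreover have "0 \<le> (hnorm H (\<rho> b x))\<^sup>2"
    by simp
  ultimately have "(hnorm H (\<rho> a x))\<^sup>2 \<le> (c * hnorm H x)\<^sup>2"
    unfolding power_mult_distrib by linarith
  then show ?thesis
    by (rule power2_le_imp_le) (intro mult_nonneg_nonneg c(1) hnorm_nonneg x)
qed

end

section \<open>A one-dimensional Hilbert space\<close>

text \<open>The complex numbers with their usual inner product, transported along \<open>e\<close> into the type of vectors.\<close>

definition line_space :: "(complex \<Rightarrow> 'x) \<Rightarrow> 'x cinner_space" where
  "line_space e =
    \<lparr>carrier = range e, monoid.mult = (\<lambda>_ _. e 0), one = e 0, zero = e 0,
     add = (\<lambda>x y. e (the_inv e x + the_inv e y)), smult = (\<lambda>c x. e (c * the_inv e x)),
     cinner = (\<lambda>x y. the_inv e x * cnj (the_inv e y))\<rparr>"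

context
  fixes e :: "complex \<Rightarrow> 'x"
  assumes inj: "inj e"
begin

lemma line_space_simps [simp]:
  "carrier (line_space e) = range e"
  "\<zero>\<^bsub>line_space e\<^esub> = e 0"
  "e u \<oplus>\<^bsub>line_space e\<^esub> e v = e (u + v)"
  "c \<odot>\<^bsub>line_space e\<^esub> e u = e (c * u)"
  "cinner (line_space e) (e u) (e v) = u * cnj v"
  using inj by (simp_all add: line_space_def the_inv_f_f)

lemma abelian_group_line_space: "abelian_group (line_space e)"
proof (rule abelian_groupI)
  fix x assume "x \<in> carrier (line_space e)"
  then obtain u where "x = e u"
    by auto
  then show "\<exists>y\<in>carrier (line_space e). y \<oplus>\<^bsub>line_space e\<^esub> x = \<zero>\<^bsub>line_space e\<^esub>"
    by (intro bexI[of _ "e (- u)"]) auto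
qed (auto simp: add_ac)

lemma line_space_minus [simp]: "e u \<ominus>\<^bsub>line_space e\<^esub> e v = e (u - v)"
proof -
  interpret abelian_group "line_space e"
    by (rule abelian_group_line_space)
  have "\<ominus>\<^bsub>line_space e\<^esub> e v = e (- v)"
    by (rule minus_equality) auto
  then show ?thesis
    by (simp add: a_minus_def)
qed

lemma hnorm_line_space [simp]: "hnorm (line_space e) (e u) = norm u"
  by (simp add: hnorm_def complex_mult_cnj cmod_def)

lemma hdist_line_space [simp]: "hdist (line_space e) (e u) (e v) = dist u v"
  by (simp add: hdist_def dist_norm)

lemma hilbert_space_line_space: "hilbert_space (line_space e)"
  unfolding hilbert_space_def
proof (intro conjI)
  show "Module.module (ring_of_type_algebra :: complex ring) (line_space e)"
    by (rule moduleI[OF cring_from_type_algebra abelian_group_line_space])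
       (auto simp: ring_of_type_algebra_def algebra_simps)
  interpret Metric_space "carrier (line_space e)" "hdist (line_space e)"
  proof
    show "0 \<le> hdist (line_space e) x y" for x y
      by (cases "x \<in> range e \<and> y \<in> range e") (auto simp: hdist_def)
    show "hdist (line_space e) x y = hdist (line_space e) y x" for x y
      by (cases "x \<in> range e \<and> y \<in> range e") (auto simp: dist_commute, auto simp: hdist_def)
  qed (auto simp: dist_triangle inj_eq[OF inj])
  show mcomplete
    unfolding mcomplete_def
  proof (intro allI impI)
    fix \<sigma> :: "nat \<Rightarrow> 'x" assume \<sigma>: "MCauchy \<sigma>"
    define u where "u n = the_inv e (\<sigma> n)" for n
    have "\<sigma> n \<in> range e" for n
      using \<sigma> unfolding MCauchy_def by auto
    then have eu: "\<sigma> n = e (u n)" for n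
      using inj by (simp add: u_def f_the_inv_into_f)
    have "Cauchy u"
      unfolding Cauchy_def
    proof (intro allI impI)
      fix \<epsilon> :: real assume "\<epsilon> > 0"
      then obtain N where "\<And>m n. \<lbrakk>N \<le> m; N \<le> n\<rbrakk> \<Longrightarrow> hdist (line_space e) (\<sigma> m) (\<sigma> n) < \<epsilon>"
        using \<sigma> unfolding MCauchy_def by blast
      then show "\<exists>N. \<forall>m\<ge>N. \<forall>n\<ge>N. dist (u m) (u n) < \<epsilon>"
        by (auto simp: eu)
    qed
    then obtain l where "u \<longlonglongrightarrow> l"
      using Cauchy_convergent_iff convergent_def by blast
    then have "limitin mtopology \<sigma> (e l) sequentially"
      unfolding limitin_metric by (auto simp: eu tendsto_iff)
    then show "\<exists>x. limitin mtopology \<sigma> x sequentially"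
      by blast
  qed
qed (auto simp: algebra_simps)

lemma bounded_operator_line_space:
  assumes "\<And>u. T (e u) = e (c * u)"
  shows "bounded_operator (line_space e) T"
  using assms unfolding bounded_operator_def
  by (auto simp: algebra_simps norm_mult intro!: exI[of _ "norm c"])

lemma line_space_cayley:
  assumes T: "\<And>u. T (e u) = e (c * u)" and c: "norm c < 1"
  shows "cayley (line_space e) T (e u) = e ((1 + c) / (1 - c) * u)"
proof -
  let ?y = "op_inverse (line_space e) (\<lambda>v. v \<ominus>\<^bsub>line_space e\<^esub> T v) (e u)"
  have "?y \<in> carrier (line_space e)" "?y = e u \<oplus>\<^bsub>line_space e\<^esub> T ?y"
    using c T by (intro op_inverse_contraction[OF hilbert_space_line_space, where q = "norm c"];
      force simp: norm_mult algebra_simps)+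
  then obtain v where v: "?y = e v" "e v = e (u + c * v)"
    by (metis T line_space_simps(1) line_space_simps(3) rangeE)
  have "1 - c \<noteq> 0"
    using c by auto
  then have "v = u / (1 - c)"
    using injD[OF inj v(2)] by (simp add: field_simps)
  then show ?thesis
    using v(1) by (simp add: cayley_def T Let_def add_divide_distrib algebra_simps)
qed

lemma point_evaluation_representation:
  assumes t: "t \<in> topspace Y"
  shows "unital_star_representation Y (line_space e) (\<lambda>a x. a t \<odot>\<^bsub>line_space e\<^esub> x)"
  unfolding unital_star_representation_def is_adjoint_def
  using t by (auto simp: Cb_star_def algebra_simps intro!: bounded_operator_line_space)

end

section \<open>The representation of functions with nonnegative real part\<close>

text \<open>The Cayley transform of \<open>h\<close>, normalized at \<open>w0\<close>, lies in the Schur class, and the maximum principle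
  leaves two possibilities: either it is a unimodular constant, or it maps into the open disc.\<close>

lemma nonneg_real_part_cases:
  fixes h :: "complex ^ 'm \<Rightarrow> complex"
  assumes dom: "domain_Cm \<Omega>" and w0: "w0 \<in> \<Omega>" and h: "holomorphic_Cm h \<Omega>"
    and Re: "\<And>z. z \<in> \<Omega> \<Longrightarrow> 0 \<le> Re (h z)"
  obtains (const) b where "\<And>z. z \<in> \<Omega> \<Longrightarrow> h z = \<i> * of_real b"
  | (test) b r \<psi> where "r > 0" "\<psi> \<in> Psi \<Omega> w0"
      "\<And>z. z \<in> \<Omega> \<Longrightarrow> h z = \<i> * of_real b + of_real r * ((1 + \<psi> z) / (1 - \<psi> z))"
proof -
  \<comment> \<open>If \<open>Re (h w0) = 0\<close>, normalizing by 1 keeps the Cayley transform defined; it then has the unimodular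
    value \<open>-1\<close> at \<open>w0\<close>.\<close>
  define r where "r = Re (h w0) + (if Re (h w0) = 0 then 1 else 0)"
  have r: "r > 0"
    using Re[OF w0] by (auto simp: r_def)
  define b where "b = Im (h w0)"
  define k where "k x = 1 - 2 * of_real r / (x - \<i> * of_real b + of_real r)" for x
  define \<phi> where "\<phi> z = k (h z)" for z
  have nz: "h z - \<i> * of_real b + of_real r \<noteq> 0" if "z \<in> \<Omega>" for z
    using Re[OF that] r by (auto simp: complex_eq_iff)
  have hol: "holomorphic_Cm \<phi> \<Omega>"
    unfolding \<phi>_def
  proof (rule holomorphic_Cm_compose_field[OF h])
    fix z assume "z \<in> \<Omega>"
    show "(k has_field_derivative (\<lambda>x. 2 * of_real r / (x - \<i> * of_real b + of_real r)\<^sup>2) (h z)) (at (h z))"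
      unfolding k_def using nz[OF \<open>z \<in> \<Omega>\<close>]
      by (auto intro!: derivative_eq_intros simp: power2_eq_square)
  qed
  have frac: "\<phi> z = (h z - \<i> * of_real b - of_real r) / (h z - \<i> * of_real b + of_real r)" if "z \<in> \<Omega>" for z
    using nz[OF that] by (simp add: \<phi>_def k_def field_simps)
  have le: "norm (\<phi> z) \<le> 1" if "z \<in> \<Omega>" for z
  proof -
    have "(norm (h z - \<i> * of_real b - of_real r))\<^sup>2 \<le> (norm (h z - \<i> * of_real b + of_real r))\<^sup>2"
      using Re[OF that] r unfolding cmod_power2 by (simp add: power2_eq_square algebra_simps)
    then have "norm (h z - \<i> * of_real b - of_real r) \<le> norm (h z - \<i> * of_real b + of_real r)"
      by (rule power2_le_imp_le) simp
    then show ?thesis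
      using nz[OF that] by (simp add: frac[OF that] norm_divide)
  qed
  have schur: "\<phi> \<in> schur_class \<Omega>"
    using hol le by (simp add: schur_class_def)
  have inverse: "h z = \<i> * of_real b + of_real r * ((1 + \<phi> z) / (1 - \<phi> z))" if "z \<in> \<Omega>" for z
  proof -
    have "1 - \<phi> z = 2 * of_real r / (h z - \<i> * of_real b + of_real r)"
      by (simp add: \<phi>_def k_def)
    moreover have "1 + \<phi> z = 2 * (h z - \<i> * of_real b) / (h z - \<i> * of_real b + of_real r)"
      using nz[OF that] by (simp add: \<phi>_def k_def field_simps)
    ultimately show ?thesis
      using nz[OF that] r by simp
  qed
  show ?thesis
  proof (cases "Re (h w0) = 0")
    case True
    then have h0: "h w0 = \<i> * of_real b"
      by (simp add: complex_eq_iff b_def)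
    then have "\<phi> w0 = -1"
      using r by (simp add: frac[OF w0])
    then have "\<phi> z = -1" if "z \<in> \<Omega>" for z
      using schur_class_unimodular_imp_constant[OF dom schur w0 _ that] by simp
    then have "h z = \<i> * of_real b" if "z \<in> \<Omega>" for z
      using inverse[OF that] that by simp
    then show ?thesis
      by (rule const)
  next
    case False
    then have "h w0 = \<i> * of_real b + of_real r"
      by (simp add: complex_eq_iff b_def r_def)
    then have \<phi>0: "\<phi> w0 = 0"
      using w0 by (simp add: frac)
    have lt: "norm (\<phi> z) < 1" if "z \<in> \<Omega>" for z
    proof (rule ccontr)
      assume "\<not> norm (\<phi> z) < 1"
      then have "norm (\<phi> z) = 1"
        using le[OF that] by simp
      then show False
        using schur_class_unimodular_imp_constant[OF dom schur that _ w0] \<phi>0 by auto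
    qed
    \<comment> \<open>The Blaschke factor at \<open>0\<close> is \<open>w \<mapsto> - w\<close>, so the sign makes \<open>\<phi>\<close> itself the test function of \<open>f\<close>.\<close>
    define f where "f z = - \<phi> z" for z
    have "holomorphic_Cm f \<Omega>"
      unfolding f_def
      by (rule holomorphic_Cm_compose_field[OF hol, where k' = "\<lambda>_. -1"]) (auto intro!: derivative_eq_intros)
    then have "(\<lambda>z\<in>\<Omega>. blaschke (f w0) (f z)) \<in> Psi \<Omega> w0"
      unfolding Psi_blaschke schur_class_def using lt le
      by (intro CollectI exI[of _ f]) (auto simp: f_def)
    moreover have "(\<lambda>z\<in>\<Omega>. blaschke (f w0) (f z)) = restrict \<phi> \<Omega>"
      by (simp add: f_def blaschke_def \<phi>0)
    ultimately show ?thesis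
      using inverse by (intro test[OF r, of "restrict \<phi> \<Omega>" b]) auto
  qed
qed

lemma topspace_test_topology_Psi:
  assumes "domain_Cm \<Omega>" "w0 \<in> \<Omega>"
  shows "topspace (test_topology \<Omega> (Psi \<Omega> w0)) = Psi \<Omega> w0"
proof -
  have "\<psi> \<in> (\<Pi>\<^sub>E z\<in>\<Omega>. cball 0 1)" if \<psi>: "\<psi> \<in> Psi \<Omega> w0" for \<psi>
  proof
    fix z assume "z \<in> \<Omega>"
    then show "\<psi> z \<in> cball 0 1"
      using Psi_uniformly_bounded[OF assms] \<psi> by (metis dist_0_norm le_less_trans less_imp_le mem_cball)
  qed (use \<psi> in \<open>auto simp: Psi_def\<close>)
  then show ?thesis
    by (auto simp: test_topology_def)
qed

lemma evaluation_in_Cb: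
  assumes z: "z \<in> \<Omega>"
  shows "evaluation (test_topology \<Omega> \<Psi>) z \<in> Cb (test_topology \<Omega> \<Psi>)"
  unfolding Cb_iff
proof (intro conjI)
  let ?Y = "test_topology \<Omega> \<Psi>"
  show "bounded (evaluation ?Y z ` topspace ?Y)"
    by (rule bounded_subset[OF bounded_cball[of 0 1]])
       (use z in \<open>auto simp: evaluation_def test_topology_def PiE_iff\<close>)
  have "continuous_map (product_topology (\<lambda>_. top_of_set (cball 0 1)) \<Omega>) (top_of_set (cball 0 1)) (\<lambda>\<psi>. \<psi> z)"
    using z by (rule continuous_map_product_projection)
  then have "continuous_map ?Y euclidean (\<lambda>\<psi>. \<psi> z)"
    unfolding test_topology_def
    by (intro continuous_map_from_subtopology) (auto simp: continuous_map_in_subtopology)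
  then show "continuous_map ?Y euclidean (evaluation ?Y z)"
    by (rule continuous_map_eq) (simp add: evaluation_def)
qed (simp add: evaluation_def)

lemma unitary_id:
  assumes "hilbert_space H"
  shows "unitary_operator H id"
proof -
  interpret abelian_group H
    using assms by (rule hilbert_abelian_group)
  have "bounded_operator H id"
    unfolding bounded_operator_def by (auto intro!: exI[of _ 1])
  then show ?thesis
    unfolding unitary_operator_def by (intro conjI exI[of _ id]) (auto simp: is_adjoint_def is_inverse_op_def)
qed

text \<open>Multiplication by \<open>c\<close> on the line has the Cayley transform \<open>(1 + c) / (1 - c)\<close>. Here \<open>c\<close> is the
  conjugate of \<open>\<psi> z\<close>, and the inner product conjugates once more.\<close>

lemma realization_from_test_function:
  fixes e :: "complex \<Rightarrow> 'x"
  assumes e: "inj e" and \<psi>: "\<psi> \<in> topspace Y" and lt: "norm (\<psi> z) < 1"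
  shows "cinner (line_space e) (e (of_real s))
      (cayley (line_space e) (\<lambda>v. id (Cb_star Y (evaluation Y z) \<psi> \<odot>\<^bsub>line_space e\<^esub> v)) (e (of_real s)))
    = of_real (s\<^sup>2) * ((1 + \<psi> z) / (1 - \<psi> z))"
proof -
  let ?T = "\<lambda>v. id (Cb_star Y (evaluation Y z) \<psi> \<odot>\<^bsub>line_space e\<^esub> v)"
  have "?T (e u) = e (cnj (\<psi> z) * u)" for u
    using \<psi> e by (simp add: Cb_star_def evaluation_def)
  then have "cayley (line_space e) ?T (e (of_real s)) = e ((1 + cnj (\<psi> z)) / (1 - cnj (\<psi> z)) * of_real s)"
    using lt by (intro line_space_cayley[OF e]) simp_all
  then show ?thesis
    using e by (simp add: power2_eq_square)
qed

lemma realization_imp_nonneg_real_part: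
  fixes H :: "('x, 'r) cinner_space_scheme"
  assumes dom: "domain_Cm \<Omega>" and w0: "w0 \<in> \<Omega>" and z: "z \<in> \<Omega>"
  defines "Y \<equiv> test_topology \<Omega> (Psi \<Omega> w0)"
  assumes H: "hilbert_space H" and U: "unitary_operator H U" and \<gamma>: "\<gamma> \<in> carrier H"
    and \<rho>: "unital_star_representation Y H \<rho>"
  shows "0 \<le> Re (cinner H \<gamma> (cayley H (\<lambda>v. U (\<rho> (Cb_star Y (evaluation Y z)) v)) \<gamma>))"
proof -
  obtain t where t: "0 \<le> t" "t < 1" "\<And>\<psi>. \<psi> \<in> Psi \<Omega> w0 \<Longrightarrow> norm (\<psi> z) \<le> t"
    using Psi_uniformly_bounded[OF dom w0 z] by metis
  let ?a = "Cb_star Y (evaluation Y z)"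
  have a: "?a \<in> Cb Y"
    unfolding Y_def using z by (intro Cb_star_in_Cb evaluation_in_Cb)
  have bound: "norm (?a \<psi>) \<le> t" if "\<psi> \<in> topspace Y" for \<psi>
    using that t(3) topspace_test_topology_Psi[OF dom w0] by (simp add: Y_def Cb_star_def evaluation_def)
  have bU: "bounded_operator H U" and b\<rho>: "bounded_operator H (\<rho> ?a)"
    using U \<rho> a unfolding unitary_operator_def unital_star_representation_def by blast+
  have \<rho>c: "\<rho> ?a x \<in> carrier H" if "x \<in> carrier H" for x
    using b\<rho> that unfolding bounded_operator_def by blast
  show ?thesis
  proof (rule Re_cinner_cayley_nonneg[OF H _ _ _ t(1,2) _ \<gamma>])
    show "(\<lambda>v. U (\<rho> ?a v)) \<in> carrier H \<rightarrow> carrier H"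
      using bU \<rho>c unfolding bounded_operator_def by blast
    show "U (\<rho> ?a (x \<oplus>\<^bsub>H\<^esub> y)) = U (\<rho> ?a x) \<oplus>\<^bsub>H\<^esub> U (\<rho> ?a y)"
      if "x \<in> carrier H" "y \<in> carrier H" for x y
      using bU b\<rho> \<rho>c that unfolding bounded_operator_def by metis
    show "U (\<rho> ?a (c \<odot>\<^bsub>H\<^esub> x)) = c \<odot>\<^bsub>H\<^esub> U (\<rho> ?a x)" if "x \<in> carrier H" for c x
      using bU b\<rho> \<rho>c that unfolding bounded_operator_def by metis
    show "hnorm H (U (\<rho> ?a x)) \<le> t * hnorm H x" if "x \<in> carrier H" for x
      using hnorm_unitary[OF H U \<rho>c[OF that]]
        star_representation_contractive[OF H \<rho> a t(1) bound that] by simp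
  qed
qed

theorem theorem3p2:
  fixes \<Omega> :: "(complex ^ 'm) set" and w0 :: "complex ^ 'm" and h :: "complex ^ 'm \<Rightarrow> complex"
  assumes "domain_Cm \<Omega>" and "caratheodory_hyperbolic \<Omega>" and "w0 \<in> \<Omega>"
    and "holomorphic_Cm h \<Omega>"
    and universe: "\<exists>e :: complex \<Rightarrow> 'x. inj e"
  defines "\<Psi> \<equiv> Psi \<Omega> w0"
  defines "Y \<equiv> test_topology \<Omega> \<Psi>"
  shows "test_functions \<Omega> \<Psi> \<and>
    ((\<forall>z\<in>\<Omega>. Re (h z) \<ge> 0) \<longleftrightarrow>
     (\<exists>(b :: real) (H :: 'x cinner_space) U \<gamma> \<rho>.
        hilbert_space H \<and> unitary_operator H U \<and> \<gamma> \<in> carrier H \<and>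
        unital_star_representation Y H \<rho> \<and>
        (\<forall>z\<in>\<Omega>. h z = \<i> * of_real b +
           cinner H \<gamma> (cayley H (\<lambda>v. U (\<rho> (Cb_star Y (evaluation Y z)) v)) \<gamma>))))"
proof (intro conjI iffI)
  show "test_functions \<Omega> \<Psi>"
    unfolding \<Psi>_def using assms(1-3) by (rule test_functions_Psi)
next
  have topY: "topspace Y = Psi \<Omega> w0"
    unfolding Y_def \<Psi>_def using assms(1,3) by (rule topspace_test_topology_Psi)
  assume Re: "\<forall>z\<in>\<Omega>. 0 \<le> Re (h z)"
  obtain b s \<psi> where \<psi>: "\<psi> \<in> Psi \<Omega> w0"
    and eq: "\<And>z. z \<in> \<Omega> \<Longrightarrow> h z = \<i> * of_real b + of_real (s\<^sup>2) * ((1 + \<psi> z) / (1 - \<psi> z))"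
  proof (rule nonneg_real_part_cases[OF assms(1,3,4)])
    show "0 \<le> Re (h z)" if "z \<in> \<Omega>" for z
      using Re that by blast
  next
    fix b assume h: "\<And>z. z \<in> \<Omega> \<Longrightarrow> h z = \<i> * complex_of_real b"
    have "(\<lambda>_. 0) \<in> schur_class \<Omega>"
      by (auto simp: schur_class_def holomorphic_Cm_def intro!: exI[of _ "\<lambda>_. 0"])
    \<comment> \<open>A purely imaginary constant needs \<open>\<gamma> = 0\<close>; the zero test function serves only to provide a representation.\<close>
    then have "(\<lambda>z\<in>\<Omega>. blaschke 0 0) \<in> Psi \<Omega> w0"
      unfolding Psi_blaschke by force
    then show thesis
      using h by (intro that[of _ b 0]) simp_all
  next
    fix b r \<psi> assume "r > 0" "\<psi> \<in> Psi \<Omega> w0"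
      "\<And>z. z \<in> \<Omega> \<Longrightarrow> h z = \<i> * complex_of_real b + complex_of_real r * ((1 + \<psi> z) / (1 - \<psi> z))"
    then show thesis
      by (intro that[of \<psi> b "sqrt r"]) simp_all
  qed
  obtain e :: "complex \<Rightarrow> 'x" where e: "inj e"
    using universe by blast
  let ?H = "line_space e" and ?\<rho> = "\<lambda>a x. a \<psi> \<odot>\<^bsub>line_space e\<^esub> x"
  have "norm (\<psi> z) < 1" if "z \<in> \<Omega>" for z
    using Psi_uniformly_bounded[OF assms(1,3) that] \<psi> by (metis le_less_trans)
  then have "\<forall>z\<in>\<Omega>. h z = \<i> * of_real b + cinner ?H (e (of_real s))
      (cayley ?H (\<lambda>v. id (?\<rho> (Cb_star Y (evaluation Y z)) v)) (e (of_real s)))"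
    using eq realization_from_test_function[OF e, of \<psi> Y _ s] \<psi> topY by simp
  moreover have "unital_star_representation Y ?H ?\<rho>"
    using point_evaluation_representation[OF e, where t = \<psi> and Y = Y] \<psi> topY by simp
  moreover have "e (of_real s) \<in> carrier ?H"
    using e by simp
  ultimately show "\<exists>(b :: real) (H :: 'x cinner_space) U \<gamma> \<rho>.
        hilbert_space H \<and> unitary_operator H U \<and> \<gamma> \<in> carrier H \<and>
        unital_star_representation Y H \<rho> \<and>
        (\<forall>z\<in>\<Omega>. h z = \<i> * of_real b +
           cinner H \<gamma> (cayley H (\<lambda>v. U (\<rho> (Cb_star Y (evaluation Y z)) v)) \<gamma>))"
    using hilbert_space_line_space[OF e] unitary_id by blast
next
  assume "\<exists>(b :: real) (H :: 'x cinner_space) U \<gamma> \<rho>.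
        hilbert_space H \<and> unitary_operator H U \<and> \<gamma> \<in> carrier H \<and>
        unital_star_representation Y H \<rho> \<and>
        (\<forall>z\<in>\<Omega>. h z = \<i> * of_real b +
           cinner H \<gamma> (cayley H (\<lambda>v. U (\<rho> (Cb_star Y (evaluation Y z)) v)) \<gamma>))"
  then show "\<forall>z\<in>\<Omega>. 0 \<le> Re (h z)"
    unfolding Y_def \<Psi>_def using realization_imp_nonneg_real_part[OF assms(1,3)] by fastforce
qed

end
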